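(* Let $\mathcal H$ be a complex Hilbert space and let $A,B\in L(\mathcal H)^+$ be such that $A$ has closed range. With respect to the decomposition $\mathcal H=R(A)\oplus N(A)$ write $A=\begin{pmatrix} a&0\\0&0\end{pmatrix}$ (so $a$ is an invertible positive operator on $R(A)$). The following conditions are equivalent: 1. $A\overset{\diamond}{\leq}B$ (diamond order); 2. there exist $y\in L(R(A),N(A))$ and $b_{22}\in L(N(A))^+$ such that $$B=\begin{pmatrix} a& G^{-1}y^*b_{22}\\ b_{22}\,y\,(G^* )^{-1}& b_{22}\end{pmatrix},\qquad\text{where } G=\tfrac12 I+\Big[\big(y^*b_{22}y+\tfrac a4\big)\# a\Big]a^{-1}.$$
   Context: $L(\mathcal H)$ is the algebra of bounded linear operators on $\mathcal H$ and $L(\mathcal H)^+$ the set of positive semi-definite ones, $\langle Tx,x\rangle\ge 0$ for all $x$; $L(\mathcal H,\mathcal K)$ denotes bounded linear operators from $\mathcal H$ to $\mathcal K$; $R(T)$, $N(T)$ are range and nullspace. Diamond order: $A\overset{\diamond}{\leq}B$ if $R(A)\subseteq R(B)$, $R(A^* )\subseteq R(B^* )$ and $AA^*A=AB^*A$. Geometric mean: for positive semi-definite operators $C,D$ on a Hilbert space $\mathcal E$, $C\# D$ is the maximum, with respect to the L\"owner order ($X\le Y$ iff $Y-X$ is positive semi-definite), of the set of $X\in L(\mathcal E)^+$ such that $\begin{pmatrix} C & X \\ X & D \end{pmatrix}\in L(\mathcal E\oplus\mathcal E)^+$. If $D$ is invertible, $C\# D=D^{1/2}(D^{-1/2}CD^{-1/2})^{1/2}D^{1/2}$.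 *)

theory Defs
  imports "HOL-Analysis.Analysis"
begin

text \<open>Complex inner product spaces are built on top of the real ones, so that norm, topology and
  completeness are those of the library. The inner product is linear in its first argument.\<close>

class complex_inner = real_inner +
  fixes scaleC :: "complex \<Rightarrow> 'a \<Rightarrow> 'a" (infixr "*\<^sub>C" 75)
    and cinner :: "'a \<Rightarrow> 'a \<Rightarrow> complex"
  assumes scaleC_add_right: "c *\<^sub>C (x + y) = c *\<^sub>C x + c *\<^sub>C y"
    and scaleC_add_left: "(c + d) *\<^sub>C x = c *\<^sub>C x + d *\<^sub>C x"
    and scaleC_scaleC: "c *\<^sub>C d *\<^sub>C x = (c * d) *\<^sub>C x"
    and scaleR_scaleC: "r *\<^sub>R x = complex_of_real r *\<^sub>C x"
    and cinner_commute: "cinner x y = cnj (cinner y x)"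
    and cinner_add_left: "cinner (x + y) z = cinner x z + cinner y z"
    and cinner_scaleC_left: "cinner (c *\<^sub>C x) y = c * cinner x y"
    and inner_eq_Re_cinner: "inner x y = Re (cinner x y)"

class complex_hilbert = complex_inner + complete_space

instantiation complex :: complex_hilbert
begin

definition "scaleC_complex (c::complex) (x::complex) = c * x"
definition "cinner_complex (x::complex) (y::complex) = x * cnj y"

instance
  by standard
    (simp_all add: scaleC_complex_def cinner_complex_def inner_complex_def algebra_simps
      scaleR_conv_of_real)

end

instantiation prod :: (complex_inner, complex_inner) complex_inner
begin

definition "scaleC_prod (c::complex) (x::'a \<times> 'b) = (c *\<^sub>C fst x, c *\<^sub>C snd x)"
definition "cinner_prod (x::'a \<times> 'b) (y::'a \<times> 'b) = cinner (fst x) (fst y) + cinner (snd x) (snd y)"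

instance
proof
  fix x y :: "'a \<times> 'b"
  show "cinner x y = cnj (cinner y x)"
    unfolding cinner_prod_def
    using cinner_commute[of "fst x" "fst y"] cinner_commute[of "snd x" "snd y"] by simp
qed (simp_all add: scaleC_prod_def cinner_prod_def inner_prod_def prod_eq_iff scaleC_add_right
      scaleC_add_left scaleC_scaleC scaleR_scaleC cinner_add_left cinner_scaleC_left
      inner_eq_Re_cinner distrib_left)

end

instance prod :: (complex_hilbert, complex_hilbert) complex_hilbert ..

text \<open>Closed subspaces (such as the range and the nullspace of a closed range operator) are Hilbert
  spaces in their own right. They are represented by carrier sets \<open>S\<close>, and an operator from
  \<open>S\<close> to \<open>T\<close> is a function on \<open>S\<close>, extensional in the sense of \<open>HOL-Library.FuncSet\<close>, so that two
  operators are equal iff they agree on \<open>S\<close>. The whole space is the carrier \<open>UNIV\<close>, where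
  extensionality is void.\<close>

definition bounded_ops :: "'a::complex_inner set \<Rightarrow> 'b::complex_inner set \<Rightarrow> ('a \<Rightarrow> 'b) set" where
  "bounded_ops S T = {f \<in> S \<rightarrow>\<^sub>E T.
     (\<forall>x\<in>S. \<forall>y\<in>S. f (x + y) = f x + f y) \<and>
     (\<forall>c. \<forall>x\<in>S. f (c *\<^sub>C x) = c *\<^sub>C f x) \<and>
     (\<exists>K. \<forall>x\<in>S. norm (f x) \<le> K * norm x)}"

definition pos_ops :: "'a::complex_inner set \<Rightarrow> ('a \<Rightarrow> 'a) set" where
  "pos_ops S = {f \<in> bounded_ops S S. \<forall>x\<in>S. cinner (f x) x \<in> \<real>\<^sub>\<ge>\<^sub>0}"

definition loewner_le :: "'a::complex_inner set \<Rightarrow> ('a \<Rightarrow> 'a) \<Rightarrow> ('a \<Rightarrow> 'a) \<Rightarrow> bool" where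
  "loewner_le S X Y \<longleftrightarrow> (\<lambda>x\<in>S. Y x - X x) \<in> pos_ops S"

definition adj_op :: "'a::complex_inner set \<Rightarrow> 'b::complex_inner set \<Rightarrow> ('a \<Rightarrow> 'b) \<Rightarrow> 'b \<Rightarrow> 'a" where
  "adj_op S T f = (THE g. g \<in> bounded_ops T S \<and>
     (\<forall>x\<in>S. \<forall>y\<in>T. cinner (f x) y = cinner x (g y)))"

text \<open>The inverse of a bijective operator on \<open>S\<close>.\<close>

definition inv_op :: "'a set \<Rightarrow> ('a \<Rightarrow> 'a) \<Rightarrow> 'a \<Rightarrow> 'a" where
  "inv_op S f = restrict (inv_into S f) S"

definition nullspace :: "('a \<Rightarrow> 'b::zero) \<Rightarrow> 'a set" where
  "nullspace f = {x. f x = 0}"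

definition diamond_le ::
  "('a::complex_hilbert \<Rightarrow> 'b::complex_hilbert) \<Rightarrow> ('a \<Rightarrow> 'b) \<Rightarrow> bool" where
  "diamond_le A B \<longleftrightarrow>
     range A \<subseteq> range B \<and>
     range (adj_op UNIV UNIV A) \<subseteq> range (adj_op UNIV UNIV B) \<and>
     A \<circ> adj_op UNIV UNIV A \<circ> A = A \<circ> adj_op UNIV UNIV B \<circ> A"

text \<open>The operator on the external direct sum of \<open>S\<close> with itself, carried by \<open>S \<times> S\<close>, with the
  2-by-2 matrix of entries \<open>C X Y D\<close> (listed row by row).\<close>

definition dsum_op :: "'a::complex_inner set \<Rightarrow> ('a \<Rightarrow> 'a) \<Rightarrow> ('a \<Rightarrow> 'a) \<Rightarrow> ('a \<Rightarrow> 'a) \<Rightarrow> ('a \<Rightarrow> 'a) \<Rightarrow>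
    'a \<times> 'a \<Rightarrow> 'a \<times> 'a" where
  "dsum_op S C X Y D = (\<lambda>(u, v)\<in>S \<times> S. (C u + X v, Y u + D v))"

definition geo_mean_set :: "'a::complex_inner set \<Rightarrow> ('a \<Rightarrow> 'a) \<Rightarrow> ('a \<Rightarrow> 'a) \<Rightarrow> ('a \<Rightarrow> 'a) set" where
  "geo_mean_set S C D = {X \<in> pos_ops S. dsum_op S C X X D \<in> pos_ops (S \<times> S)}"

definition geo_mean :: "'a::complex_inner set \<Rightarrow> ('a \<Rightarrow> 'a) \<Rightarrow> ('a \<Rightarrow> 'a) \<Rightarrow> 'a \<Rightarrow> 'a" where
  "geo_mean S C D = (THE M. M \<in> geo_mean_set S C D \<and> (\<forall>X \<in> geo_mean_set S C D. loewner_le S X M))"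

definition orth_proj :: "'a::complex_inner set \<Rightarrow> 'a \<Rightarrow> 'a" where
  "orth_proj S x = (THE p. p \<in> S \<and> (\<forall>z\<in>S. cinner (x - p) z = 0))"

text \<open>The operator on the whole space with the 2-by-2 matrix of entries \<open>f11 f12 f21 f22\<close> with
  respect to an orthogonal decomposition into the closed subspaces \<open>S\<close> and \<open>T\<close>.\<close>

definition block_op :: "'a::complex_hilbert set \<Rightarrow> 'a set \<Rightarrow>
    ('a \<Rightarrow> 'a) \<Rightarrow> ('a \<Rightarrow> 'a) \<Rightarrow> ('a \<Rightarrow> 'a) \<Rightarrow> ('a \<Rightarrow> 'a) \<Rightarrow> 'a \<Rightarrow> 'a" where
  "block_op S T f11 f12 f21 f22 = (\<lambda>x.
     let u = orth_proj S x; v = orth_proj T x in (f11 u + f12 v) + (f21 u + f22 v))"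

end

theory Submission
  imports Defs
begin

text \<open>Write \<open>R = R(A)\<close>, \<open>N = N(A)\<close> and \<open>C = y\<^sup>* b\<^sub>2\<^sub>2 y\<close>. The diamond order says that the \<open>R\<close>-corner of \<open>B\<close> is
  \<open>a\<close> and that \<open>R \<subseteq> R(B)\<close>, i.e. that the Schur complement \<open>s\<close> of \<open>b\<^sub>2\<^sub>2\<close> in \<open>B\<close> is invertible on \<open>R\<close>.
  On the other side, put \<open>P = G a = a/2 + (C + a/4) # a\<close>. Since \<open>M = (C + a/4) # a\<close> is the positive solution
  of \<open>M a\<^sup>-\<^sup>1 M = C + a/4\<close>, the operator \<open>P\<close> satisfies \<open>P a\<^sup>-\<^sup>1 P - P = C\<close>, and this is exactly what makes the
  Schur complement of the block operator equal to the invertible operator \<open>a P\<^sup>-\<^sup>1 a\<close>. Conversely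
  \<open>P = a s\<^sup>-\<^sup>1 a\<close> and \<open>y = W s\<^sup>-\<^sup>1 a\<close>, with \<open>b\<^sub>2\<^sub>2 W = b\<^sub>2\<^sub>1\<close>, bring \<open>B\<close> into block form, and \<open>s \<le> a\<close> gives
  \<open>P - a/2 \<ge> a/2 \<ge> 0\<close>, so that \<open>P - a/2\<close> is the geometric mean.\<close>

subsection \<open>Bounded and symmetric operators on closed subspaces\<close>

text \<open>The quadratic equation for \<open>P\<close> is the Schur identity in disguise:
  \<open>a = s + W' b22 W\<close>, with \<open>W'\<close> the adjoint of \<open>W\<close>,
  multiplied by \<open>a s^-1\<close> on the left and by \<open>s^-1 a\<close> on the right, reads
  \<open>P a^-1 P = P + C\<close>. Completing the square to
  \<open>(P - a/2) a^-1 (P - a/2) = C + a/4\<close> accounts for the constants 1/2 and 1/4 of the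
  theorem. The obstacle is that \<open>b22\<close> need not be invertible and the range of
  \<open>B\<close> need not be closed, so \<open>s\<close> and \<open>W\<close> cannot be written
  with inverses. They are reached by choosing preimages under \<open>B\<close> vector by vector.
  Such choices carry neither linearity nor continuity; both are recovered from adjoint identities,
  the second through a Baire category argument. The analysis is carried by the real inner product,
  and complex linearity returns as commutation with multiplication by the imaginary unit.\<close>

lemma riesz_on_subspace:
  fixes f :: "'a::{real_inner,banach} \<Rightarrow> real"
  assumes S: "subspace S" "closed S"
    and add: "\<And>x y. x \<in> S \<Longrightarrow> y \<in> S \<Longrightarrow> f (x + y) = f x + f y"
    and scale: "\<And>r x. x \<in> S \<Longrightarrow> f (r *\<^sub>R x) = r * f x"
    and bound: "\<And>x. x \<in> S \<Longrightarrow> \<bar>f x\<bar> \<le> K * norm x"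
  obtains p where "p \<in> S" "\<And>x. x \<in> S \<Longrightarrow> f x = inner p x"
proof -
  \<comment> \<open>If \<open>p\<close> is the representing vector sought, \<open>J z\<close> is the
    squared distance from \<open>z\<close> to \<open>p\<close> up to a constant, so \<open>p\<close>
    must be its minimizer over \<open>S\<close>.\<close>
  define J where "J z = inner z z - 2 * f z" for z
  define m where "m = Inf (J ` S)"
  have S0: "0 \<in> S" using S(1) by (rule subspace_0)
  have bdd: "bdd_below (J ` S)"
  proof (rule bdd_belowI2)
    fix z assume "z \<in> S"
    then have "f z \<le> K * norm z" using bound by (meson abs_le_D1)
    moreover have "0 \<le> (norm z - K)\<^sup>2" by simp
    ultimately show "- K\<^sup>2 \<le> J z"
      by (simp add: J_def power2_diff flip: power2_norm_eq_inner) (simp add: mult.commute)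
  qed
  have m_le: "m \<le> J z" if "z \<in> S" for z
    unfolding m_def using bdd that by (simp add: cInf_lower)
  \<comment> \<open>Parallelogram law: at the midpoint \<open>J\<close> is the average of
    \<open>J x\<close> and \<open>J y\<close> less a quarter of the squared distance, yet at least
    \<open>m\<close>. Minimizing sequences are therefore Cauchy.\<close>
  have mid: "norm (x - y) ^ 2 \<le> 2 * (J x - m) + 2 * (J y - m)" if "x \<in> S" "y \<in> S" for x y
  proof -
    have "x + y \<in> S" using S(1) that by (rule subspace_add)
    then have h: "(1/2) *\<^sub>R (x + y) \<in> S" using S(1) by (simp add: subspace_scale)
    have "f ((1/2) *\<^sub>R (x + y)) = (1/2) * (f x + f y)"
      using scale[OF \<open>x + y \<in> S\<close>] add[OF that] by simp
    then have "J ((1/2) *\<^sub>R (x + y)) = (J x + J y) / 2 - norm (x - y) ^ 2 / 4"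
      by (simp add: J_def power2_norm_eq_inner inner_add_left inner_add_right inner_diff_left
          inner_diff_right inner_commute field_simps)
    then show ?thesis using m_le[OF h] by (simp add: field_simps)
  qed
  have "\<exists>z\<in>S. J z < m + e" if "e > 0" for e
  proof -
    have "m < m + e" using that by simp
    then show ?thesis unfolding m_def using cInf_lessD[of "J ` S"] S0 by blast
  qed
  then have "\<forall>n. \<exists>z. z \<in> S \<and> J z < m + inverse (real (Suc n))"
    by (metis inverse_positive_iff_positive of_nat_0_less_iff zero_less_Suc)
  then obtain z where zS: "\<And>n. z n \<in> S" and zJ: "\<And>n. J (z n) < m + inverse (real (Suc n))"
    by metis
  have "Cauchy z"
  proof (rule metric_CauchyI)
    fix e :: real assume e: "e > 0"
    then obtain N where N: "inverse (real (Suc N)) < e\<^sup>2 / 4"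
      using reals_Archimedean[of "e\<^sup>2/4"] e by (metis zero_less_divide_iff zero_less_numeral zero_less_power)
    show "\<exists>M. \<forall>i\<ge>M. \<forall>j\<ge>M. dist (z i) (z j) < e"
    proof (intro exI allI impI)
      fix i j assume "N \<le> i" "N \<le> j"
      then have "inverse (real (Suc i)) \<le> inverse (real (Suc N))"
        "inverse (real (Suc j)) \<le> inverse (real (Suc N))" by (simp_all add: le_imp_inverse_le)
      then have "J (z i) - m < e\<^sup>2 / 4" "J (z j) - m < e\<^sup>2 / 4"
        using zJ[of i] zJ[of j] N by (simp_all only: diff_less_eq)
      then have "norm (z i - z j) ^ 2 < e\<^sup>2"
        using mid[OF zS zS, of i j] by argo
      then show "dist (z i) (z j) < e"
        using e by (simp add: dist_norm power2_less_imp_less)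
    qed
  qed
  then obtain p where p: "z \<longlonglongrightarrow> p" by (auto dest!: Cauchy_convergent simp: convergent_def)
  have pS: "p \<in> S" by (rule closed_sequentially[OF S(2) zS p])
  have diff: "f (x - y) = f x - f y" if "x \<in> S" "y \<in> S" for x y
    using add[of x "(-1) *\<^sub>R y"] scale[of y "-1"] that S(1) by (simp add: subspace_neg)
  have "(\<lambda>n. f (z n)) \<longlonglongrightarrow> f p"
  proof (rule LIM_zero_cancel, rule Lim_null_comparison)
    show "\<forall>\<^sub>F n in sequentially. norm (f (z n) - f p) \<le> K * norm (z n - p)"
      using bound[OF subspace_diff[OF S(1) zS pS]] diff[OF zS pS] by simp
    have "(\<lambda>n. norm (z n - p)) \<longlonglongrightarrow> 0" using p LIM_zero tendsto_norm_zero by blast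
    then show "(\<lambda>n. K * norm (z n - p)) \<longlonglongrightarrow> 0" using tendsto_mult_right_zero by blast
  qed
  then have "(\<lambda>n. J (z n)) \<longlonglongrightarrow> J p" unfolding J_def using p by (intro tendsto_intros)
  moreover have "(\<lambda>n. m + inverse (real (Suc n))) \<longlonglongrightarrow> m + 0"
    by (intro tendsto_intros LIMSEQ_inverse_real_of_nat)
  ultimately have "J p \<le> m + 0"
    using zJ by (meson LIMSEQ_le less_imp_le)
  have "f x = inner p x" if x: "x \<in> S" for x
  proof (rule ccontr)
    define d where "d = f x - inner p x"
    assume "f x \<noteq> inner p x"
    then have d: "d \<noteq> 0" by (simp add: d_def)
    have xx: "inner x x > 0"
      using d scale[OF x, of 0] scale[OF S0, of 0] by (cases "x = 0") (auto simp: d_def)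
    \<comment> \<open>The minimizer of \<open>J\<close> on the line through \<open>p\<close> in
      direction \<open>x\<close>; it would lower the value by
      \<open>d^2 / inner x x\<close>.\<close>
    define t where "t = d / inner x x"
    have "J p \<le> J (p + t *\<^sub>R x)"
      using m_le[of "p + t *\<^sub>R x"] \<open>J p \<le> m + 0\<close> pS x S(1)
      by (simp add: subspace_add subspace_scale)
    moreover have "J (p + t *\<^sub>R x) = J p - 2 * t * d + t * t * inner x x"
      using add[OF pS subspace_scale[OF S(1) x]] scale[OF x, of t]
      by (simp add: J_def d_def inner_add_left inner_add_right inner_commute algebra_simps)
    ultimately have "2 * t * d \<le> t * t * inner x x" by linarith
    then have "d * d \<le> 0" using xx by (simp add: t_def field_simps)
    then show False using d by (auto simp: mult_le_0_iff)
  qed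
  then show ?thesis using pS that by blast
qed

text \<open>The vector representing \<open>inner x\<close> on \<open>S\<close> is the projection of
  \<open>x\<close>.\<close>

lemma orthogonal_projection_exists:
  fixes x :: "'a::{real_inner,banach}"
  assumes "subspace S" "closed S"
  obtains p where "p \<in> S" "\<And>z. z \<in> S \<Longrightarrow> inner (x - p) z = 0"
proof (rule riesz_on_subspace[OF assms, of "inner x" "norm x"])
  show "\<bar>inner x z\<bar> \<le> norm x * norm z" for z by (rule Cauchy_Schwarz_ineq2)
qed (auto simp: inner_add_right inner_diff_left intro: that)

text \<open>A Hellinger-Toeplitz theorem: the closed sets \<open>F n\<close>, on which the
  functionals given by \<open>g\<close> are bounded by \<open>n\<close>, exhaust \<open>S\<close>,
  so by Baire one of them contains a relative ball. Testing against \<open>Z\<close> is enough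
  because \<open>f x\<close> lies in its closure. This supplies norm bounds for operators built by
  choice.\<close>

lemma pointwise_adjoint_imp_bounded:
  fixes f :: "'a::{real_inner,banach} \<Rightarrow> 'b::real_inner"
  assumes S: "subspace S" "closed S"
    and fZ: "\<And>x. x \<in> S \<Longrightarrow> f x \<in> closure Z"
    and g: "\<And>x z. x \<in> S \<Longrightarrow> z \<in> Z \<Longrightarrow> inner (f x) z = inner x (g z)"
  obtains K where "0 \<le> K" "\<And>x. x \<in> S \<Longrightarrow> norm (f x) \<le> K * norm x"
proof -
  define F where "F n = {x \<in> S. \<forall>z\<in>Z. \<bar>inner x (g z)\<bar> \<le> real n * norm z}" for n
  have F: "F n = S \<inter> (\<Inter>z\<in>Z. {x. \<bar>inner x (g z)\<bar> \<le> real n * norm z})" for n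
    by (auto simp: F_def)
  have clF: "closedin (top_of_set S) (F n)" for n
    unfolding F by (intro closedin_closed_Int closed_INT ballI closed_Collect_le continuous_intros)
  have "x \<in> (\<Union>n. F n)" if x: "x \<in> S" for x
  proof -
    obtain n where n: "norm (f x) \<le> real n" using real_arch_simple by blast
    have "\<bar>inner x (g z)\<bar> \<le> real n * norm z" if "z \<in> Z" for z
      using g[OF x that] Cauchy_Schwarz_ineq2[of "f x" z] n
      by (smt (verit) mult_right_mono norm_ge_zero)
    then show ?thesis using x by (auto simp: F_def)
  qed
  then have UF: "(\<Union>n. F n) = S" by (auto simp: F_def)
  have "\<exists>n. top_of_set S interior_of F n \<noteq> {}"
  proof (rule ccontr)
    assume "\<not> ?thesis"
    then have "top_of_set S interior_of \<Union>(range F) = {}"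
      using clF S(2)
      by (intro Baire_category_alt disjI1 completely_metrizable_space_closedin
          completely_metrizable_space_euclidean) auto
    moreover have "top_of_set S interior_of S = S"
      by (metis interior_of_topspace topspace_euclidean_subtopology)
    ultimately show False using UF subspace_0[OF S(1)] by auto
  qed
  then obtain n x0 where "x0 \<in> top_of_set S interior_of F n" by blast
  then obtain U where "openin (top_of_set S) U" "x0 \<in> U" "U \<subseteq> F n"
    by (auto simp: interior_of_def)
  then obtain e where e: "e > 0" and ball: "\<And>x. x \<in> S \<Longrightarrow> dist x x0 < e \<Longrightarrow> x \<in> F n"
    unfolding openin_euclidean_subtopology_iff by (metis in_mono)
  have x0: "x0 \<in> F n" using \<open>x0 \<in> U\<close> \<open>U \<subseteq> F n\<close> by blast
  define K where "K = 4 * real n / e"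
  have K: "0 \<le> K" using e by (simp add: K_def)
  have weak: "\<bar>inner (f x) z\<bar> \<le> K * norm x * norm z" if x: "x \<in> S" and z: "z \<in> Z" for x z
  proof (cases "x = 0")
    case True
    then show ?thesis using g[OF x z] by simp
  next
    case False
    \<comment> \<open>Places \<open>x0 + r x\<close> at distance \<open>e / 2\<close> from
      \<open>x0\<close>. Combining the bounds at both points gives \<open>2 n norm z / r\<close>,
      whence the constant \<open>K\<close>.\<close>
    define r where "r = e / (2 * norm x)"
    have r: "r > 0" using e False by (simp add: r_def)
    have "x0 + r *\<^sub>R x \<in> S" using x x0 S(1) by (simp add: F_def subspace_add subspace_scale)
    moreover have "dist (x0 + r *\<^sub>R x) x0 < e" using e False by (simp add: dist_norm r_def)
    ultimately have "x0 + r *\<^sub>R x \<in> F n" by (rule ball)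
    then have "\<bar>inner (x0 + r *\<^sub>R x) (g z)\<bar> \<le> real n * norm z" "\<bar>inner x0 (g z)\<bar> \<le> real n * norm z"
      using x0 z by (auto simp: F_def)
    then have "\<bar>r * inner x (g z)\<bar> \<le> 2 * real n * norm z" by (simp add: inner_add_left)
    then have "\<bar>inner x (g z)\<bar> \<le> 2 * real n * norm z / r"
      using r by (simp add: abs_mult pos_le_divide_eq mult.commute)
    also have "\<dots> = K * norm x * norm z" using e False by (simp add: K_def r_def field_simps)
    finally show ?thesis using g[OF x z] by simp
  qed
  have "norm (f x) \<le> K * norm x" if x: "x \<in> S" for x
  proof -
    have "closed {z. \<bar>inner (f x) z\<bar> \<le> K * norm x * norm z}"
      by (intro closed_Collect_le continuous_intros)
    then have "closure Z \<subseteq> {z. \<bar>inner (f x) z\<bar> \<le> K * norm x * norm z}"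
      using weak[OF x] by (intro closure_minimal) auto
    then have "\<bar>inner (f x) (f x)\<bar> \<le> K * norm x * norm (f x)" using fZ[OF x] by blast
    then have "norm (f x) * norm (f x) \<le> K * norm x * norm (f x)"
      by (simp flip: power2_norm_eq_inner power2_eq_square)
    then show ?thesis using K by (cases "f x = 0") (auto simp: mult_le_cancel_right)
  qed
  then show ?thesis using K that by blast
qed

text \<open>Only the symmetry identity is recorded. On a closed subspace of a complete space it
  entails real linearity and boundedness, so an operator defined by pointwise choice is controlled
  by checking this one identity.\<close>

definition symmetric_on :: "'a::real_inner set \<Rightarrow> ('a \<Rightarrow> 'a) \<Rightarrow> bool" where
  "symmetric_on S T \<longleftrightarrow> T \<in> S \<rightarrow> S \<and> (\<forall>x\<in>S. \<forall>y\<in>S. inner (T x) y = inner x (T y))"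

lemma symmetric_onD:
  assumes "symmetric_on S T" "x \<in> S"
  shows "T x \<in> S" "y \<in> S \<Longrightarrow> inner (T x) y = inner x (T y)"
  using assms by (auto simp: symmetric_on_def)

lemma subspace_inner_eqI:
  fixes x y :: "'a::real_inner"
  assumes "subspace S" "x \<in> S" "y \<in> S" "\<And>z. z \<in> S \<Longrightarrow> inner x z = inner y z"
  shows "x = y"
proof -
  have "x - y \<in> S" using assms by (simp add: subspace_diff)
  then have "inner (x - y) (x - y) = 0" using assms(4) by (simp add: inner_diff_left)
  then show ?thesis by simp
qed

lemma symmetric_on_add:
  assumes "subspace S" "symmetric_on S T" "x \<in> S" "y \<in> S"
  shows "T (x + y) = T x + T y"
proof (rule subspace_inner_eqI[OF assms(1)])
  show "inner (T (x + y)) z = inner (T x + T y) z" if "z \<in> S" for z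
    using assms that by (simp add: symmetric_onD(2)[OF assms(2)] subspace_add inner_add_left)
qed (use assms symmetric_onD(1)[OF assms(2)] in \<open>simp_all add: subspace_add\<close>)

lemma symmetric_on_scale:
  assumes "subspace S" "symmetric_on S T" "x \<in> S"
  shows "T (r *\<^sub>R x) = r *\<^sub>R T x"
proof (rule subspace_inner_eqI[OF assms(1)])
  show "inner (T (r *\<^sub>R x)) z = inner (r *\<^sub>R T x) z" if "z \<in> S" for z
    using assms that by (simp add: symmetric_onD(2)[OF assms(2)] subspace_scale)
qed (use assms symmetric_onD(1)[OF assms(2)] in \<open>simp_all add: subspace_scale\<close>)

lemma symmetric_on_bounded:
  fixes T :: "'a::{real_inner,banach} \<Rightarrow> 'a"
  assumes "subspace S" "closed S" "symmetric_on S T"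
  obtains K where "0 < K" "\<And>x. x \<in> S \<Longrightarrow> norm (T x) \<le> K * norm x"
proof -
  obtain K where K: "0 \<le> K" "\<And>x. x \<in> S \<Longrightarrow> norm (T x) \<le> K * norm x"
  proof (rule pointwise_adjoint_imp_bounded[OF assms(1,2), of T S T])
    show "T x \<in> closure S" if "x \<in> S" for x
      using symmetric_onD(1)[OF assms(3) that] closure_subset by blast
  qed (use symmetric_onD(2)[OF assms(3)] in blast)+
  have "norm (T x) \<le> (K + 1) * norm x" if "x \<in> S" for x
    using K(2)[OF that] by (simp add: distrib_right add_increasing2)
  then show ?thesis using K(1) that[of "K + 1"] by simp
qed

lemma symmetric_on_Cauchy_Schwarz:
  fixes T :: "'a::real_inner \<Rightarrow> 'a"
  assumes S: "subspace S" and T: "symmetric_on S T"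
    and pos: "\<And>x. x \<in> S \<Longrightarrow> 0 \<le> inner (T x) x"
    and x: "x \<in> S" and y: "y \<in> S"
  shows "(inner (T x) y)\<^sup>2 \<le> inner (T x) x * inner (T y) y"
proof -
  have q: "0 \<le> inner (T x) x + 2 * t * inner (T x) y + t * t * inner (T y) y" for t
  proof -
    have ty: "t *\<^sub>R y \<in> S" using S y by (simp add: subspace_scale)
    have "0 \<le> inner (T (x + t *\<^sub>R y)) (x + t *\<^sub>R y)" using pos S x ty by (simp add: subspace_add)
    also have "T (x + t *\<^sub>R y) = T x + t *\<^sub>R T y"
      using S T x y ty by (simp add: symmetric_on_add symmetric_on_scale)
    finally show ?thesis using symmetric_onD(2)[OF T y x]
      by (simp add: inner_add_left inner_add_right inner_commute algebra_simps)
  qed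
  show ?thesis
  proof (cases "inner (T y) y = 0")
    case True
    have "inner (T x) y = 0"
    proof (rule ccontr)
      assume *: "inner (T x) y \<noteq> 0"
      \<comment> \<open>With a vanishing quadratic term, this \<open>t\<close> makes the expression
        equal to -1.\<close>
      show False
        using q[of "- (inner (T x) x + 1) / (2 * inner (T x) y)"] pos[OF x] True *
        by (simp add: field_simps)
    qed
    then show ?thesis using True by simp
  next
    case False
    then have p: "inner (T y) y > 0" using pos[OF y] by simp
    show ?thesis
      using q[of "- inner (T x) y / inner (T y) y"] p
      by (simp add: field_simps power2_eq_square)
  qed
qed

text \<open>In operator form, \<open>0 <= T <= K\<close> implies \<open>T^2 <= K T\<close>:
  Cauchy-Schwarz for the form of \<open>T\<close>, applied to \<open>x\<close> and
  \<open>T x\<close>. For \<open>B\<close> it later turns \<open>inner (B v) v = 0\<close> into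
  \<open>B v = 0\<close>.\<close>

lemma symmetric_on_norm_le:
  fixes T :: "'a::real_inner \<Rightarrow> 'a"
  assumes S: "subspace S" and T: "symmetric_on S T"
    and pos: "\<And>x. x \<in> S \<Longrightarrow> 0 \<le> inner (T x) x"
    and K: "\<And>x. x \<in> S \<Longrightarrow> inner (T x) x \<le> K * (norm x)\<^sup>2"
    and x: "x \<in> S"
  shows "(norm (T x))\<^sup>2 \<le> K * inner (T x) x"
proof -
  have Tx: "T x \<in> S" using symmetric_onD(1)[OF T x] .
  have "(inner (T x) (T x))\<^sup>2 \<le> inner (T x) x * inner (T (T x)) (T x)"
    by (rule symmetric_on_Cauchy_Schwarz[OF S T pos x Tx])
  also have "\<dots> \<le> inner (T x) x * (K * (norm (T x))\<^sup>2)"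
    by (rule mult_left_mono[OF K[OF Tx] pos[OF x]])
  finally have le: "(norm (T x))\<^sup>2 * (norm (T x))\<^sup>2 \<le> (K * inner (T x) x) * (norm (T x))\<^sup>2"
    by (simp add: power2_eq_square[of "(norm (T x))\<^sup>2"] mult_ac flip: power2_norm_eq_inner)
  show ?thesis
  proof (cases "T x = 0")
    case False
    then have "(norm (T x))\<^sup>2 > 0" by simp
    then show ?thesis using le by (rule mult_right_le_imp_le[rotated])
  qed simp
qed

lemma inner_le_of_norm_le:
  fixes x y :: "'a::real_inner"
  assumes "norm y \<le> K * norm x"
  shows "inner y x \<le> K * (norm x)\<^sup>2"
  using norm_cauchy_schwarz[of y x] mult_right_mono[OF assms norm_ge_zero[of x]]
  by (simp add: power2_eq_square)

text \<open>The Lax-Milgram argument: the lower bound makes \<open>T\<close> injective with closed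
  range, and a vector of \<open>S\<close> orthogonal to the range has zero form, so it vanishes by
  coercivity.\<close>

lemma symmetric_on_coercive_surj:
  fixes T :: "'a::{real_inner,banach} \<Rightarrow> 'a"
  assumes S: "subspace S" "closed S" and T: "symmetric_on S T"
    and c: "c > 0" "\<And>x. x \<in> S \<Longrightarrow> c * (norm x)\<^sup>2 \<le> inner (T x) x"
  shows "bij_betw T S S"
proof -
  have diff: "T (x - y) = T x - T y" if "x \<in> S" "y \<in> S" for x y
    using symmetric_on_add[OF S(1) T, of x "(-1) *\<^sub>R y"] symmetric_on_scale[OF S(1) T, of y "-1"] that S(1)
    by (simp add: subspace_neg)
  have low: "c * norm x \<le> norm (T x)" if "x \<in> S" for x
  proof -
    have "c * norm x * norm x \<le> norm (T x) * norm x"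
      using c(2)[OF that] norm_cauchy_schwarz[of "T x" x] by (simp add: power2_eq_square)
    then show ?thesis by (cases "x = 0") (auto simp: mult_le_cancel_right)
  qed
  have inj: "inj_on T S"
  proof (rule inj_onI)
    fix x y assume "x \<in> S" "y \<in> S" "T x = T y"
    then have "c * norm (x - y) \<le> 0" using low[of "x - y"] diff[of x y] S(1) by (simp add: subspace_diff)
    then show "x = y" using c(1) by (simp add: mult_le_0_iff)
  qed
  have sub: "T ` S \<subseteq> S" using symmetric_onD(1)[OF T] by blast
  have subT: "subspace (T ` S)"
  proof (rule subspaceI)
    show "0 \<in> T ` S"
      using symmetric_on_scale[OF S(1) T subspace_0[OF S(1)], of 0] subspace_0[OF S(1)]
      by (intro image_eqI[of _ _ 0]) auto
    show "x + y \<in> T ` S" if "x \<in> T ` S" "y \<in> T ` S" for x y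
      using that S(1) by (auto simp flip: symmetric_on_add[OF S(1) T] intro: subspace_add)
    show "r *\<^sub>R x \<in> T ` S" if "x \<in> T ` S" for r x
      using that S(1) by (auto simp flip: symmetric_on_scale[OF S(1) T] intro: subspace_scale)
  qed
  have clT: "closed (T ` S)"
  proof (unfold closed_sequential_limits, intro allI impI, elim conjE)
    fix y l assume y: "\<forall>n. y n \<in> T ` S" and l: "y \<longlonglongrightarrow> l"
    define x where "x n = inv_into S T (y n)" for n
    have x: "x n \<in> S" "y n = T (x n)" for n
      using y by (simp_all add: x_def inv_into_into f_inv_into_f)
    have lS: "l \<in> S" using closed_sequentially[OF S(2) _ l] sub y by blast
    have "Cauchy x"
    proof (rule metric_CauchyI)
      fix e :: real assume "e > 0"
      then have "c * e > 0" using c(1) by simp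
      then obtain M where M: "\<And>i j. i \<ge> M \<Longrightarrow> j \<ge> M \<Longrightarrow> dist (y i) (y j) < c * e"
        using LIMSEQ_imp_Cauchy[OF l] metric_CauchyD by metis
      show "\<exists>M. \<forall>i\<ge>M. \<forall>j\<ge>M. dist (x i) (x j) < e"
      proof (intro exI allI impI)
        fix i j assume "M \<le> i" "M \<le> j"
        then have "c * norm (x i - x j) < c * e"
          using M[of i j] low[of "x i - x j"] diff[of "x i" "x j"] x S(1)
          by (simp add: dist_norm subspace_diff)
        then show "dist (x i) (x j) < e" using c(1) by (simp add: dist_norm)
      qed
    qed
    then obtain p where p: "x \<longlonglongrightarrow> p" by (auto dest!: Cauchy_convergent simp: convergent_def)
    have pS: "p \<in> S" by (rule closed_sequentially[OF S(2) x(1) p])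
    \<comment> \<open>The limit is identified weakly: symmetry moves \<open>T\<close> onto the test
      vector, where only the convergence of \<open>x n\<close> enters.\<close>
    have "T p = l"
    proof (rule subspace_inner_eqI[OF S(1) symmetric_onD(1)[OF T pS] lS])
      fix z assume z: "z \<in> S"
      have "(\<lambda>n. inner (y n) z) \<longlonglongrightarrow> inner l z" using l by (intro tendsto_intros)
      moreover have "(\<lambda>n. inner (y n) z) \<longlonglongrightarrow> inner p (T z)"
        unfolding x(2) symmetric_onD(2)[OF T x(1) z] using p by (intro tendsto_intros)
      ultimately show "inner (T p) z = inner l z"
        using LIMSEQ_unique symmetric_onD(2)[OF T pS z] by metis
    qed
    then show "l \<in> T ` S" using pS by blast
  qed
  have "S \<subseteq> T ` S"
  proof
    fix r assume r: "r \<in> S"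
    obtain p where p: "p \<in> T ` S" "\<And>z. z \<in> T ` S \<Longrightarrow> inner (r - p) z = 0"
      using orthogonal_projection_exists[OF subT clT] by metis
    define d where "d = r - p"
    have dS: "d \<in> S" using r p(1) sub S(1) by (auto simp: d_def subspace_diff)
    have "inner (T d) d = 0" using p(2)[of "T d"] dS by (simp add: d_def inner_commute)
    then have "c * (norm d)\<^sup>2 \<le> 0" using c(2)[OF dS] by simp
    then have "d = 0" using c(1) by (simp add: mult_le_0_iff)
    then show "r \<in> T ` S" using p(1) by (simp add: d_def)
  qed
  then show ?thesis using inj sub by (auto simp: bij_betw_def)
qed

subsection \<open>Square roots\<close>

text \<open>After rescaling, \<open>T = I - Z\<close> with \<open>norm Z < 1\<close>, and \<open>I - Y\<close> is a square root of \<open>T\<close> iff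
  \<open>Y = (Z + Y\<^sup>2) / 2\<close>, which is a contraction on a small ball.\<close>

lemma symmetric_coercive_sqrt:
  fixes T :: "'a::{real_inner,banach} \<Rightarrow> 'a"
  assumes T: "symmetric_on UNIV T" and c: "c > 0" "\<And>x. c * (norm x)\<^sup>2 \<le> inner (T x) x"
  obtains Q d where "symmetric_on UNIV Q" "d > 0" "\<And>x. d * (norm x)\<^sup>2 \<le> inner (Q x) x"
    "\<And>x. Q (Q x) = T x"
    "\<And>J x. bounded_linear J \<Longrightarrow> (\<And>x. J (T x) = T (J x)) \<Longrightarrow> J (Q x) = Q (J x)"
proof -
  obtain K where K: "0 < K" "\<And>x. norm (T x) \<le> K * norm x"
    using symmetric_on_bounded[OF subspace_UNIV closed_UNIV T] by auto
  have Tadd: "T (x + y) = T x + T y" for x y using symmetric_on_add[OF subspace_UNIV T] by simp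
  have Tscale: "T (r *\<^sub>R x) = r *\<^sub>R T x" for x r using symmetric_on_scale[OF subspace_UNIV T] by simp
  have Tsym: "inner (T x) y = inner x (T y)" for x y using symmetric_onD(2)[OF T] by simp
  \<comment> \<open>With this scale \<open>Z = I - T/k\<close> satisfies
    \<open>0 <= Z <= z < 1\<close>: the upper bound of \<open>T\<close> gives positivity, and
    coercivity gives \<open>1 - c/k = K/k\<close>.\<close>
  define k where "k = K + c"
  define z where "z = K / k"
  have k: "k > 0" using K c by (simp add: k_def)
  have z: "0 < z" "z < 1" "1 - c / k = z" using K c k by (auto simp: z_def k_def field_simps)
  have blT: "bounded_linear T"
    by (rule bounded_linear_intro[of _ K]) (simp_all add: Tadd Tscale K mult.commute[of _ K])
  define Z where "Z = id_blinfun - (1/k) *\<^sub>R Blinfun T"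
  have Zx: "blinfun_apply Z x = x - (1/k) *\<^sub>R T x" for x
    by (simp add: Z_def bounded_linear_Blinfun_apply[OF blT] blinfun.diff_left blinfun.scaleR_left)
  have Zsym: "inner (Z x) y = inner x (Z y)" for x y
    by (simp add: Zx inner_diff_left inner_diff_right Tsym)
  have Zsymon: "symmetric_on UNIV Z" using Zsym by (simp add: symmetric_on_def)
  have Tle: "inner (T x) x \<le> K * (norm x)\<^sup>2" for x using inner_le_of_norm_le K(2) by blast
  have Zpos: "0 \<le> inner (Z x) x" for x
  proof -
    have "inner (T x) x \<le> k * (norm x)\<^sup>2"
      using Tle[of x] c(1) by (simp add: k_def distrib_right add_increasing2)
    then show ?thesis using k by (simp add: Zx inner_diff_left power2_norm_eq_inner field_simps)
  qed
  have Zle: "inner (Z x) x \<le> z * (norm x)\<^sup>2" for x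
  proof -
    have "c / k * (norm x)\<^sup>2 \<le> inner (T x) x / k"
      using c(2)[of x] k by (simp add: divide_right_mono)
    then have "(1 - z) * (norm x)\<^sup>2 \<le> inner (T x) x / k" by (simp flip: z(3))
    then show ?thesis by (simp add: Zx inner_diff_left power2_norm_eq_inner algebra_simps)
  qed
  have Znorm: "norm Z \<le> z"
  proof (rule norm_blinfun_bound)
    fix x
    have "(norm (Z x))\<^sup>2 \<le> z * inner (Z x) x"
      using symmetric_on_norm_le[OF subspace_UNIV Zsymon, of z x] Zpos Zle by simp
    also have "\<dots> \<le> z * (z * (norm x)\<^sup>2)" using Zle z(1) by (simp add: mult_left_mono)
    also have "\<dots> = (z * norm x)\<^sup>2" by (simp add: power2_eq_square)
    finally show "norm (Z x) \<le> z * norm x" by (rule power2_le_imp_le) (use z(1) in simp)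
  qed (use z(1) in simp)
  \<comment> \<open>The smaller root of \<open>q^2 - 2 q + z = 0\<close>, the scalar fixed point
    equation. Hence the ball of radius \<open>q\<close> is mapped into itself, and
    \<open>q < 1\<close> is also the contraction constant.\<close>
  define q where "q = 1 - sqrt (1 - z)"
  have "sqrt (1 - z) > 0" "sqrt (1 - z) \<le> 1" using z(1,2) by auto
  then have q: "0 \<le> q" "q < 1" by (auto simp: q_def)
  have "(1 - q)\<^sup>2 = 1 - z" using z(1,2) by (simp add: q_def)
  then have qz: "z + q * q = 2 * q" by (simp add: power2_eq_square algebra_simps)
  define comm where "comm = {J. bounded_linear J \<and> (\<forall>x. J (T x) = T (J x))}"
  \<comment> \<open>Symmetry and commutation with \<open>comm\<close> are closed conditions
    preserved by \<open>\<Phi>\<close>; building them into the complete set hands them to the fixed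
    point.\<close>
  define \<Y> where "\<Y> = {Y :: 'a \<Rightarrow>\<^sub>L 'a. norm Y \<le> q} \<inter>
     (\<Inter>x. \<Inter>y. {Y. inner (blinfun_apply Y x) y = inner x (blinfun_apply Y y)}) \<inter>
     (\<Inter>J\<in>comm. \<Inter>x. {Y. J (blinfun_apply Y x) = blinfun_apply Y (J x)})"
  define \<Phi> where "\<Phi> Y = (1/2) *\<^sub>R (Z + (Y o\<^sub>L Y))" for Y
  have contY: "continuous_on UNIV (\<lambda>Y. blinfun_apply Y x)" for x :: 'a
    by (intro continuous_intros)
  have "closed \<Y>"
    unfolding \<Y>_def
  proof (intro closed_Int closed_INT ballI)
    show "closed {Y :: 'a \<Rightarrow>\<^sub>L 'a. norm Y \<le> q}" by (intro closed_Collect_le continuous_intros)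
    show "closed {Y :: 'a \<Rightarrow>\<^sub>L 'a. inner (blinfun_apply Y x) y = inner x (blinfun_apply Y y)}" for x y
      by (intro closed_Collect_eq continuous_intros)
    show "closed {Y :: 'a \<Rightarrow>\<^sub>L 'a. J (blinfun_apply Y x) = blinfun_apply Y (J x)}" if "J \<in> comm" for J x
    proof (intro closed_Collect_eq contY)
      show "continuous_on UNIV (\<lambda>Y. J (blinfun_apply Y x))"
        using that by (intro bounded_linear.continuous_on[OF _ contY]) (simp add: comm_def)
    qed
  qed
  then have "complete \<Y>" by (simp add: complete_eq_closed)
  moreover have "\<Y> \<noteq> {}"
  proof -
    have "0 \<in> \<Y>" using q(1) by (auto simp: \<Y>_def comm_def linear_simps)
    then show ?thesis by blast
  qed
  moreover have "\<Phi> ` \<Y> \<subseteq> \<Y>"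
  proof (rule image_subsetI)
    fix Y assume Y: "Y \<in> \<Y>"
    have "norm (Z + (Y o\<^sub>L Y)) \<le> norm Z + norm Y * norm Y"
      by (intro norm_triangle_le add_left_mono norm_blinfun_compose)
    also have "\<dots> \<le> z + q * q" using Znorm Y by (intro add_mono mult_mono) (auto simp: \<Y>_def q(1))
    finally have "norm (\<Phi> Y) \<le> q" using qz by (simp add: \<Phi>_def)
    moreover have "inner (\<Phi> Y x) y = inner x (\<Phi> Y y)" for x y
    proof -
      have "inner (blinfun_apply Y x) y = inner x (blinfun_apply Y y)" for x y
        using Y by (auto simp: \<Y>_def)
      then show ?thesis
        by (simp add: \<Phi>_def blinfun.scaleR_left blinfun.add_left inner_add_left inner_add_right Zsym)
    qed
    moreover have "J (\<Phi> Y x) = \<Phi> Y (J x)" if J: "J \<in> comm" for J x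
    proof -
      have "J (blinfun_apply Y x) = blinfun_apply Y (J x)" for x
        using Y J by (auto simp: \<Y>_def)
      moreover have "bounded_linear J" "J (T x) = T (J x)" using J by (auto simp: comm_def)
      ultimately show ?thesis
        by (simp add: \<Phi>_def blinfun.scaleR_left blinfun.add_left Zx linear_simps)
    qed
    ultimately show "\<Phi> Y \<in> \<Y>" by (auto simp: \<Y>_def)
  qed
  moreover have "dist (\<Phi> X) (\<Phi> Y) \<le> q * dist X Y" if "X \<in> \<Y>" "Y \<in> \<Y>" for X Y
  proof -
    have "\<Phi> X - \<Phi> Y = (1/2) *\<^sub>R ((X o\<^sub>L (X - Y)) + ((X - Y) o\<^sub>L Y))"
      by (rule blinfun_eqI)
        (simp add: \<Phi>_def blinfun.scaleR_left blinfun.add_left blinfun.diff_left blinfun.diff_right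
          scaleR_diff_right scaleR_add_right)
    then have "norm (\<Phi> X - \<Phi> Y) = norm ((X o\<^sub>L (X - Y)) + ((X - Y) o\<^sub>L Y)) / 2" by simp
    also have "norm ((X o\<^sub>L (X - Y)) + ((X - Y) o\<^sub>L Y)) \<le> norm X * norm (X - Y) + norm (X - Y) * norm Y"
      by (intro norm_triangle_le add_mono norm_blinfun_compose)
    also have "\<dots> \<le> q * norm (X - Y) + norm (X - Y) * q"
      using that by (intro add_mono mult_right_mono mult_left_mono) (auto simp: \<Y>_def)
    finally show ?thesis by (simp add: dist_norm mult.commute)
  qed
  ultimately obtain Y where Y: "Y \<in> \<Y>" "\<Phi> Y = Y" using Banach_fix[of \<Y> q \<Phi>] q by blast
  have Ysym: "inner (blinfun_apply Y x) y = inner x (blinfun_apply Y y)" for x y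
    using Y(1) by (auto simp: \<Y>_def)
  have YY: "Y (Y x) = 2 *\<^sub>R Y x - Z x" for x
  proof -
    have "Y x = (1/2) *\<^sub>R (Z x + Y (Y x))"
      using arg_cong[OF Y(2), of "\<lambda>Y. blinfun_apply Y x"]
      by (simp add: \<Phi>_def blinfun.scaleR_left blinfun.add_left)
    then have "2 *\<^sub>R Y x = 2 *\<^sub>R ((1/2) *\<^sub>R (Z x + Y (Y x)))" by (rule arg_cong)
    also have "\<dots> = Z x + Y (Y x)" by simp
    finally have "2 *\<^sub>R Y x = Z x + Y (Y x)" .
    then show ?thesis by simp
  qed
  define Q where "Q x = sqrt k *\<^sub>R (x - Y x)" for x
  show ?thesis
  proof (rule that)
    show "symmetric_on UNIV Q"
      by (simp add: symmetric_on_def Q_def inner_diff_left inner_diff_right Ysym)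
    show "sqrt k * (1 - q) > 0" using k q by simp
    show "sqrt k * (1 - q) * (norm x)\<^sup>2 \<le> inner (Q x) x" for x
    proof -
      have "norm (Y x) \<le> q * norm x"
        using Y(1) norm_blinfun[of Y x] mult_right_mono[of "norm Y" q "norm x"] by (auto simp: \<Y>_def)
      then have "(1 - q) * (norm x)\<^sup>2 \<le> inner (x - Y x) x"
        using inner_le_of_norm_le[of "Y x" q x]
        by (simp add: inner_diff_left power2_norm_eq_inner algebra_simps)
      then show ?thesis using k by (simp add: Q_def mult.assoc mult_left_mono)
    qed
    show "Q (Q x) = T x" for x
    proof -
      have "Q (Q x) = k *\<^sub>R (x - 2 *\<^sub>R Y x + Y (Y x))"
        using k by (simp add: Q_def blinfun.scaleR_right blinfun.diff_right scaleR_2 algebra_simps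
            flip: real_sqrt_mult)
      also have "\<dots> = T x" using k by (simp add: YY Zx)
      finally show ?thesis .
    qed
    show "J (Q x) = Q (J x)" if "bounded_linear J" "\<And>x. J (T x) = T (J x)" for J x
    proof -
      have "J \<in> comm" using that by (simp add: comm_def)
      then have "J (Y x) = Y (J x)" using Y(1) by (auto simp: \<Y>_def)
      then show ?thesis using that(1) by (simp add: Q_def linear_simps)
    qed
  qed
qed

lemma symmetric_on_UNIV_bounded_linear:
  fixes T :: "'a::{real_inner,banach} \<Rightarrow> 'a"
  assumes "symmetric_on UNIV T"
  shows "bounded_linear T"
proof -
  obtain K where "0 < K" "\<And>x. norm (T x) \<le> K * norm x"
    using symmetric_on_bounded[OF subspace_UNIV closed_UNIV assms] by auto
  then show ?thesis
    by (intro bounded_linear_intro[of _ K])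
      (simp_all add: symmetric_on_add[OF subspace_UNIV assms] symmetric_on_scale[OF subspace_UNIV assms]
        mult.commute[of _ K])
qed

lemma symmetric_on_combine:
  assumes "subspace S" "symmetric_on S T" "symmetric_on S U"
  shows "symmetric_on S (\<lambda>x. r *\<^sub>R T x + t *\<^sub>R U x)"
  using assms symmetric_onD[OF assms(2)] symmetric_onD[OF assms(3)]
  by (auto simp: symmetric_on_def subspace_add subspace_scale inner_add_left inner_add_right)

subsection \<open>Riccati equations and the operator order\<close>

text \<open>The map \<open>X \<mapsto> X a\<^sup>-\<^sup>1 X\<close> reflects the order of positive operators. If \<open>t > 0\<close> and
  \<open>E = M - X + t a\<close> is positive, then \<open>E\<close> even dominates a positive multiple of \<open>a\<close>, so the least
  such \<open>t\<close> is zero.\<close>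

lemma riccati_order_reflecting:
  fixes a ai M X :: "'a::{real_inner,banach} \<Rightarrow> 'a"
  assumes S: "subspace S" "closed S"
    and a: "symmetric_on S a" and ai: "symmetric_on S ai" "\<And>x. x \<in> S \<Longrightarrow> ai (a x) = x"
    and c: "c > 0" "\<And>x. x \<in> S \<Longrightarrow> c * (norm x)\<^sup>2 \<le> inner (a x) x"
    and M: "symmetric_on S M" "\<And>x. x \<in> S \<Longrightarrow> 0 \<le> inner (M x) x"
    and X: "symmetric_on S X"
    and le: "\<And>x. x \<in> S \<Longrightarrow> inner (X x) (ai (X x)) \<le> inner (M x) (ai (M x))"
    and u: "u \<in> S"
  shows "inner (X u) u \<le> inner (M u) u"
proof -
  define D where "D x = M x - X x" for x
  have D: "symmetric_on S D" using symmetric_on_combine[OF S(1) M(1) X, of 1 "-1"] by (simp add: D_def[abs_def])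
  \<comment> \<open>The nonnegative \<open>t\<close> for which \<open>D + t a\<close> is positive;
    the infimum is attained since the set is closed.\<close>
  define good where "good = {0..} \<inter> (\<Inter>x\<in>S. {t. 0 \<le> inner (D x) x + t * inner (a x) x})"
  have step: "\<exists>s\<in>good. s < t" if tg: "t \<in> good" and t: "t > 0" for t
  proof -
    define E where "E x = D x + t *\<^sub>R a x" for x
    have E: "symmetric_on S E" using symmetric_on_combine[OF S(1) D a, of 1 t] by (simp add: E_def[abs_def])
    have Epos: "0 \<le> inner (E x) x" if "x \<in> S" for x
      using tg that by (simp add: good_def E_def inner_add_left)
    \<comment> \<open>Pairing \<open>D x\<close> with this vector gives
      \<open>inner (M x) (ai (M x)) - inner (X x) (ai (X x))\<close>, since the cross terms cancel
      by symmetry of \<open>ai\<close>: a noncommutative factoring of a difference of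
      squares.\<close>
    define h where "h x = ai (M x + X x)" for x
    have MX: "symmetric_on S (\<lambda>x. M x + X x)" using symmetric_on_combine[OF S(1) M(1) X, of 1 1] by simp
    obtain k1 where k1: "k1 > 0" "\<And>x. x \<in> S \<Longrightarrow> norm (E x) \<le> k1 * norm x"
      using symmetric_on_bounded[OF S E] by blast
    obtain k2 where k2: "k2 > 0" "\<And>x. x \<in> S \<Longrightarrow> norm (ai x) \<le> k2 * norm x"
      using symmetric_on_bounded[OF S ai(1)] by blast
    obtain k3 where k3: "k3 > 0" "\<And>x. x \<in> S \<Longrightarrow> norm (M x + X x) \<le> k3 * norm x"
      using symmetric_on_bounded[OF S MX] by blast
    \<comment> \<open>Chosen so that \<open>inner (E (h x)) (h x) <= K * inner (a x) x\<close>: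
      \<open>k2 * k3\<close> bounds \<open>h\<close>, and coercivity of \<open>a\<close> absorbs the
      squared norm of \<open>x\<close>.\<close>
    define K where "K = k1 * (k2 * k3)\<^sup>2 / c"
    have K: "K > 0" using k1 k2 k3 c by (simp add: K_def)
    \<comment> \<open>Read off from the final estimate
      \<open>t^2/2 * \<alpha> <= (t + K / (2 t^2)) * e\<close>.\<close>
    define \<epsilon> where "\<epsilon> = (t\<^sup>2 / 2) / (t + K / (2 * t\<^sup>2))"
    have den: "t + K / (2 * t\<^sup>2) > 0" using t K by (simp add: add_pos_pos)
    have \<epsilon>: "\<epsilon> > 0" using den t by (simp add: \<epsilon>_def)
    have main: "\<epsilon> * inner (a x) x \<le> inner (E x) x" if x: "x \<in> S" for x
    proof -
      define e where "e = inner (E x) x"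
      define \<alpha> where "\<alpha> = inner (a x) x"
      have MXx: "M x + X x \<in> S" by (rule symmetric_onD(1)[OF MX x])
      have hS: "h x \<in> S" using MXx symmetric_onD(1)[OF ai(1)] by (simp add: h_def)
      have e0: "0 \<le> e" using Epos[OF x] by (simp add: e_def)
      have \<alpha>0: "c * (norm x)\<^sup>2 \<le> \<alpha>" using c(2)[OF x] by (simp add: \<alpha>_def)
      have "norm (h x) \<le> k2 * (k3 * norm x)"
        unfolding h_def using k2(2)[OF MXx] k3(2)[OF x] k2(1) by (meson mult_left_mono less_imp_le order_trans)
      then have "(norm (h x))\<^sup>2 \<le> (k2 * k3)\<^sup>2 * (norm x)\<^sup>2"
        by (metis mult.assoc norm_ge_zero power_mono power_mult_distrib)
      then have "k1 * (norm (h x))\<^sup>2 \<le> k1 * ((k2 * k3)\<^sup>2 * (norm x)\<^sup>2)"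
        using k1(1) by simp
      also have "\<dots> = K * (c * (norm x)\<^sup>2)" using c(1) by (simp add: K_def)
      also have "\<dots> \<le> K * \<alpha>" using \<alpha>0 K by simp
      finally have "inner (E (h x)) (h x) \<le> K * \<alpha>"
        using inner_le_of_norm_le[OF k1(2)[OF hS]] by linarith
      then have "(inner (E x) (h x))\<^sup>2 \<le> e * (K * \<alpha>)"
        using symmetric_on_Cauchy_Schwarz[OF S(1) E Epos x hS] e0
        unfolding e_def by (meson mult_left_mono order_trans)
      \<comment> \<open>Arithmetic-geometric mean inequality, weighted so that only half of
        \<open>t^2 * \<alpha>\<close> is given away; the other half survives against the lower
        bound.\<close>
      also have "\<dots> \<le> (t\<^sup>2 * \<alpha> / 2 + K * e / (2 * t\<^sup>2))\<^sup>2"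
      proof -
        have "0 \<le> (t\<^sup>2 * \<alpha> / 2 - K * e / (2 * t\<^sup>2))\<^sup>2" by simp
        also have "\<dots> = (t\<^sup>2 * \<alpha> / 2 + K * e / (2 * t\<^sup>2))\<^sup>2 - e * (K * \<alpha>)"
          using t by (simp add: power2_eq_square field_simps)
        finally show ?thesis by simp
      qed
      finally have up: "inner (E x) (h x) \<le> t\<^sup>2 * \<alpha> / 2 + K * e / (2 * t\<^sup>2)"
      proof (rule power2_le_imp_le)
        have "0 \<le> \<alpha>" using \<alpha>0 c(1) by (meson mult_nonneg_nonneg less_imp_le order_trans zero_le_power2)
        then show "0 \<le> t\<^sup>2 * \<alpha> / 2 + K * e / (2 * t\<^sup>2)" using K e0 by simp
      qed
      have Mx: "M x \<in> S" and Xx: "X x \<in> S" and ax: "a x \<in> S"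
        using symmetric_onD(1)[OF M(1) x] symmetric_onD(1)[OF X x] symmetric_onD(1)[OF a x] by auto
      have "inner (D x) (h x) = inner (M x) (ai (M x)) - inner (X x) (ai (X x))"
        using symmetric_onD(2)[OF ai(1) Mx Xx]
        by (simp add: D_def h_def symmetric_on_add[OF S(1) ai(1) Mx Xx] inner_diff_left inner_add_right
            inner_diff_right inner_commute)
      then have "0 \<le> inner (D x) (h x)" using le[OF x] by simp
      moreover have "inner (a x) (h x) = inner x (M x + X x)"
        using symmetric_onD(2)[OF ai(1) ax MXx] ai(2)[OF x] by (simp add: h_def)
      ultimately have low: "t * inner x (M x + X x) \<le> inner (E x) (h x)"
        by (simp add: E_def inner_add_left)
      \<comment> \<open>The left side equals \<open>inner (X x) x - inner (M x) x\<close>;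
        positivity of \<open>M\<close> allows the last sign to be changed.\<close>
      have "t * \<alpha> - e \<le> inner x (M x + X x)"
        using M(2)[OF x]
        by (simp add: e_def \<alpha>_def E_def D_def inner_add_left inner_add_right inner_diff_left inner_diff_right
            inner_commute)
      then have "t * (t * \<alpha> - e) \<le> inner (E x) (h x)"
        using low t by (meson mult_left_mono less_imp_le order_trans)
      then have "t\<^sup>2 / 2 * \<alpha> \<le> (t + K / (2 * t\<^sup>2)) * e"
        using up by (simp add: power2_eq_square algebra_simps)
      then have "t\<^sup>2 / 2 * \<alpha> / (t + K / (2 * t\<^sup>2)) \<le> e"
        unfolding pos_divide_le_eq[OF den] by (simp only: mult.commute)
      then show ?thesis by (simp only: \<epsilon>_def e_def \<alpha>_def times_divide_eq_left)
    qed
    define s where "s = max 0 (t - \<epsilon>)"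
    have "0 \<le> inner (D x) x + s * inner (a x) x" if x: "x \<in> S" for x
    proof -
      have "0 \<le> c * (norm x)\<^sup>2" using c(1) by simp
      then have "0 \<le> inner (a x) x" using c(2)[OF x] by linarith
      then have "(t - \<epsilon>) * inner (a x) x \<le> s * inner (a x) x" by (intro mult_right_mono) (simp add: s_def)
      then show ?thesis using main[OF x] by (simp add: E_def inner_add_left algebra_simps)
    qed
    then have "s \<in> good" by (simp add: good_def s_def)
    then show ?thesis using \<epsilon> t by (intro bexI[of _ s]) (simp_all add: s_def)
  qed
  obtain k where k: "k > 0" "\<And>x. x \<in> S \<Longrightarrow> norm (D x) \<le> k * norm x"
    using symmetric_on_bounded[OF S D] by blast
  have "k / c \<in> good"
  proof -
    have "0 \<le> inner (D x) x + k / c * inner (a x) x" if x: "x \<in> S" for x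
    proof -
      have "- inner (D x) x \<le> k * (norm x)\<^sup>2"
        using inner_le_of_norm_le[of "- D x" k x] k(2)[OF x] by simp
      also have "\<dots> = k / c * (c * (norm x)\<^sup>2)" using c(1) by simp
      also have "\<dots> \<le> k / c * inner (a x) x" using c k by (intro mult_left_mono c(2)[OF x]) simp
      finally show ?thesis by simp
    qed
    then show ?thesis using k c by (simp add: good_def)
  qed
  then have ne: "good \<noteq> {}" by blast
  have bdd: "bdd_below good" by (rule bdd_belowI[of _ 0]) (simp add: good_def)
  have "closed good"
    unfolding good_def by (intro closed_Int closed_INT ballI closed_Collect_le continuous_intros)
  then have inf: "Inf good \<in> good" using ne bdd closed_contains_Inf by blast
  have "Inf good = 0"
  proof (rule ccontr)
    assume "Inf good \<noteq> 0"
    then have "Inf good > 0" using inf by (simp add: good_def)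
    then obtain s where "s \<in> good" "s < Inf good" using step inf by blast
    then show False using cInf_lower[OF _ bdd] by fastforce
  qed
  then show ?thesis using inf u by (simp add: good_def D_def inner_diff_left)
qed

subsection \<open>Complex Hilbert spaces\<close>

instance complex_hilbert \<subseteq> banach ..

definition csubspace :: "'a::complex_inner set \<Rightarrow> bool" where
  "csubspace S \<longleftrightarrow> subspace S \<and> (\<forall>c. \<forall>x\<in>S. c *\<^sub>C x \<in> S)"

lemma csubspaceD:
  assumes "csubspace S"
  shows "subspace S" "x \<in> S \<Longrightarrow> c *\<^sub>C x \<in> S" "x \<in> S \<Longrightarrow> y \<in> S \<Longrightarrow> x + y \<in> S"
    "x \<in> S \<Longrightarrow> y \<in> S \<Longrightarrow> x - y \<in> S" "x \<in> S \<Longrightarrow> r *\<^sub>R x \<in> S" "x \<in> S \<Longrightarrow> - x \<in> S" "0 \<in> S"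
  using assms by (auto simp: csubspace_def subspace_add subspace_diff subspace_scale subspace_neg subspace_0)

lemma csubspace_UNIV: "csubspace UNIV"
  by (simp add: csubspace_def)

lemma csubspace_Times: "csubspace S \<Longrightarrow> csubspace T \<Longrightarrow> csubspace (S \<times> T)"
  by (auto simp: csubspace_def subspace_Times scaleC_prod_def)

section \<open>Rules for the complex inner product and scalar multiplication\<close>

lemma cinner_add_right: "cinner x (y + z) = cinner x y + cinner x z"
  by (metis cinner_add_left cinner_commute complex_cnj_add)

lemma cinner_scaleC_right: "cinner x (c *\<^sub>C y) = cnj c * cinner x y"
  by (metis cinner_commute cinner_scaleC_left complex_cnj_mult)

lemma scaleC_eq_scaleR: "c *\<^sub>C x = Re c *\<^sub>R x + Im c *\<^sub>R (\<i> *\<^sub>C x)"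
proof -
  have "c *\<^sub>C x = (complex_of_real (Re c) + complex_of_real (Im c) * \<i>) *\<^sub>C x"
    by (metis complex_eq mult.commute)
  then show ?thesis by (simp add: scaleC_add_left scaleR_scaleC scaleC_scaleC)
qed

lemma scaleC_scaleR_commute: "c *\<^sub>C (r *\<^sub>R x) = r *\<^sub>R (c *\<^sub>C x)"
  by (simp add: scaleR_scaleC scaleC_scaleC mult.commute)

lemma cinner_scaleR_left: "cinner (r *\<^sub>R x) y = of_real r * cinner x y"
  by (simp add: scaleR_scaleC cinner_scaleC_left)

lemma cinner_scaleR_right: "cinner x (r *\<^sub>R y) = of_real r * cinner x y"
  by (simp add: scaleR_scaleC cinner_scaleC_right)

lemma cinner_minus_left: "cinner (- x) y = - cinner x y"
  using cinner_scaleR_left[of "-1" x y] by simp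

lemma cinner_minus_right: "cinner x (- y) = - cinner x y"
  using cinner_scaleR_right[of x "-1" y] by simp

lemma cinner_diff_left: "cinner (x - y) z = cinner x z - cinner y z"
  using cinner_add_left[of x "- y" z] by (simp add: cinner_minus_left)

lemma cinner_diff_right: "cinner z (x - y) = cinner z x - cinner z y"
  using cinner_add_right[of z x "- y"] by (simp add: cinner_minus_right)

lemma cinner_zero [simp]: "cinner 0 x = 0" "cinner x 0 = 0"
  using cinner_scaleR_left[of 0 x x] cinner_scaleR_right[of x 0 x] by simp_all

lemmas cinner_simps = cinner_add_left cinner_add_right cinner_diff_left cinner_diff_right
  cinner_minus_left cinner_minus_right cinner_scaleR_left cinner_scaleR_right

lemma scaleC_minus_right: "c *\<^sub>C (- x) = - (c *\<^sub>C x)"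
  using scaleC_scaleR_commute[of c "-1" x] by simp

lemma Im_cinner: "Im (cinner x y) = inner x (\<i> *\<^sub>C y)"
  by (simp add: inner_eq_Re_cinner cinner_scaleC_right)

lemma cinner_eqI:
  assumes "inner x y = inner x' y'" "inner x (\<i> *\<^sub>C y) = inner x' (\<i> *\<^sub>C y')"
  shows "cinner x y = cinner x' y'"
  using assms by (simp add: complex_eq_iff Im_cinner) (simp add: inner_eq_Re_cinner)

lemma inner_ii_left: "inner (\<i> *\<^sub>C x) y = - inner x (\<i> *\<^sub>C y)"
  by (simp add: inner_eq_Re_cinner cinner_scaleC_left cinner_scaleC_right)

lemma inner_of_cinner: "cinner x y = cinner x' y' \<Longrightarrow> inner x y = inner x' y'"
  by (simp add: inner_eq_Re_cinner)

lemma ii_ii: "\<i> *\<^sub>C \<i> *\<^sub>C x = - x"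
  using scaleR_scaleC[of "-1" x] by (simp add: scaleC_scaleC)

lemma bounded_linear_ii: "bounded_linear (\<lambda>x::'a::complex_inner. \<i> *\<^sub>C x)"
proof (rule bounded_linear_intro[of _ 1])
  show "norm (\<i> *\<^sub>C x) \<le> norm x * 1" for x :: 'a
    by (simp add: norm_eq_sqrt_inner inner_ii_left ii_ii)
qed (simp_all add: scaleC_add_right scaleC_scaleR_commute)

lemma bounded_linear_scaleC: "bounded_linear (\<lambda>x::'a::complex_inner. c *\<^sub>C x)"
proof -
  have "bounded_linear (\<lambda>x::'a. Re c *\<^sub>R x + Im c *\<^sub>R (\<i> *\<^sub>C x))"
    by (intro bounded_linear_add bounded_linear_scaleR_right bounded_linear_compose[OF bounded_linear_scaleR_right]
        bounded_linear_ii)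
  then show ?thesis by (subst scaleC_eq_scaleR)
qed

lemma csubspace_closure:
  assumes S: "csubspace S"
  shows "csubspace (closure S)"
proof -
  have scale: "c *\<^sub>C x \<in> closure S" if "x \<in> closure S" for c x
  proof -
    have "c *\<^sub>C x \<in> closure ((\<lambda>x. c *\<^sub>C x) ` S)"
      using closure_bounded_linear_image_subset[OF bounded_linear_scaleC] that by blast
    also have "\<dots> \<subseteq> closure S" using S by (intro closure_mono) (auto simp: csubspaceD)
    finally show ?thesis .
  qed
  have "x + y \<in> closure S" if xy: "x \<in> closure S" "y \<in> closure S" for x y
  proof -
    obtain f g where f: "\<And>n. f n \<in> S" "f \<longlonglongrightarrow> x" and g: "\<And>n. g n \<in> S" "g \<longlonglongrightarrow> y"
      using xy unfolding closure_sequential by blast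
    have "(\<lambda>n. f n + g n) \<longlonglongrightarrow> x + y" by (intro tendsto_add f g)
    moreover have "f n + g n \<in> S" for n by (rule csubspaceD(3)[OF S f(1) g(1)])
    ultimately show ?thesis
      unfolding closure_sequential by (intro exI[of _ "\<lambda>n. f n + g n"]) simp
  qed
  moreover have "0 \<in> closure S" using csubspaceD(7)[OF S] closure_subset by blast
  ultimately show ?thesis
    using scale by (auto simp: csubspace_def subspace_def scaleR_scaleC)
qed

lemma csubspace_cinner_eqI:
  assumes "csubspace S" "x \<in> S" "y \<in> S" "\<And>z. z \<in> S \<Longrightarrow> cinner x z = cinner y z"
  shows "x = y"
  by (intro subspace_inner_eqI[OF csubspaceD(1)[OF assms(1)] assms(2,3)] inner_of_cinner assms(4))

section \<open>Complex symmetric and positive operators on carriers\<close>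

definition csymmetric_on :: "'a::complex_inner set \<Rightarrow> ('a \<Rightarrow> 'a) \<Rightarrow> bool" where
  "csymmetric_on S T \<longleftrightarrow> T \<in> S \<rightarrow> S \<and> (\<forall>x\<in>S. \<forall>y\<in>S. cinner (T x) y = cinner x (T y))"

lemma csymmetric_onD:
  assumes "csymmetric_on S T"
  shows "symmetric_on S T" "x \<in> S \<Longrightarrow> T x \<in> S"
    "x \<in> S \<Longrightarrow> y \<in> S \<Longrightarrow> cinner (T x) y = cinner x (T y)"
  using assms inner_of_cinner unfolding csymmetric_on_def symmetric_on_def by blast+

lemma csymmetric_on_cong:
  assumes "\<And>x. x \<in> S \<Longrightarrow> T x = U x"
  shows "csymmetric_on S T \<longleftrightarrow> csymmetric_on S U"
  using assms by (auto simp: csymmetric_on_def Pi_iff)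

lemma symmetric_on_imp_csymmetric_on:
  assumes "csubspace S" "symmetric_on S T" "\<And>x. x \<in> S \<Longrightarrow> T (\<i> *\<^sub>C x) = \<i> *\<^sub>C T x"
  shows "csymmetric_on S T"
  unfolding csymmetric_on_def
proof (intro conjI ballI)
  show "T \<in> S \<rightarrow> S" using assms(2) by (simp add: symmetric_on_def)
  show "cinner (T x) y = cinner x (T y)" if "x \<in> S" "y \<in> S" for x y
  proof (rule cinner_eqI)
    show "inner (T x) y = inner x (T y)" by (rule symmetric_onD(2)[OF assms(2) that])
    show "inner (T x) (\<i> *\<^sub>C y) = inner x (\<i> *\<^sub>C T y)"
      using symmetric_onD(2)[OF assms(2) that(1) csubspaceD(2)[OF assms(1) that(2)]] assms(3)[OF that(2)]
      by simp
  qed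
qed

text \<open>The set \<open>Z\<close> separates the vectors of \<open>T\<close>, which gives
  linearity, and the Baire argument gives the bound. Testing on \<open>Z\<close> alone serves the
  operator \<open>W\<close> attached to a diamond pair, whose adjoint is accessible only on the
  range of \<open>b22\<close>.\<close>

lemma weak_adjoint_bounded_ops:
  fixes S :: "'a::complex_hilbert set" and T :: "'b::complex_hilbert set"
  assumes S: "csubspace S" "closed S" and T: "csubspace T" "T \<subseteq> closure Z"
    and f: "\<And>x. x \<in> S \<Longrightarrow> f x \<in> T"
    and fg: "\<And>x z. x \<in> S \<Longrightarrow> z \<in> Z \<Longrightarrow> cinner (f x) z = cinner x (g z)"
  shows "restrict f S \<in> bounded_ops S T"
proof -
  obtain K where K: "\<And>x. x \<in> S \<Longrightarrow> norm (f x) \<le> K * norm x"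
  proof (rule pointwise_adjoint_imp_bounded[OF csubspaceD(1)[OF S(1)] S(2), of f Z g])
    show "f x \<in> closure Z" if "x \<in> S" for x using f[OF that] T(2) by blast
  qed (use fg inner_of_cinner in blast)+
  have eq: "x = y" if xy: "x \<in> T" "y \<in> T" "\<And>z. z \<in> Z \<Longrightarrow> cinner x z = cinner y z" for x y
  proof -
    have "closed {z. inner (x - y) z = 0}" by (intro closed_Collect_eq continuous_intros)
    moreover have "inner (x - y) z = 0" if "z \<in> Z" for z
      using inner_of_cinner[OF xy(3)[OF that]] by (simp add: inner_diff_left)
    ultimately have "closure Z \<subseteq> {z. inner (x - y) z = 0}" by (intro closure_minimal) auto
    moreover have "x - y \<in> closure Z" using T(2) csubspaceD(4)[OF T(1) xy(1,2)] by blast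
    ultimately have "inner (x - y) (x - y) = 0" by blast
    then show "x = y" by simp
  qed
  have "f (x + y) = f x + f y" if "x \<in> S" "y \<in> S" for x y
    using that by (intro eq) (simp_all add: f fg csubspaceD[OF S(1)] csubspaceD[OF T(1)] cinner_add_left)
  moreover have "f (c *\<^sub>C x) = c *\<^sub>C f x" if "x \<in> S" for c x
    using that by (intro eq) (simp_all add: f fg csubspaceD[OF S(1)] csubspaceD[OF T(1)] cinner_scaleC_left)
  ultimately show ?thesis using K f by (auto simp: bounded_ops_def csubspaceD[OF S(1)] intro!: exI[of _ K])
qed

lemma adjoint_pair_bounded_ops:
  fixes S :: "'a::complex_hilbert set" and T :: "'b::complex_hilbert set"
  assumes S: "csubspace S" "closed S" and T: "csubspace T"
    and f: "\<And>x. x \<in> S \<Longrightarrow> f x \<in> T"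
    and fg: "\<And>x y. x \<in> S \<Longrightarrow> y \<in> T \<Longrightarrow> cinner (f x) y = cinner x (g y)"
  shows "restrict f S \<in> bounded_ops S T"
  by (rule weak_adjoint_bounded_ops[OF S T closure_subset f fg])

lemma bounded_opsD:
  assumes "f \<in> bounded_ops S T"
  shows "x \<in> S \<Longrightarrow> f x \<in> T" "x \<in> S \<Longrightarrow> y \<in> S \<Longrightarrow> f (x + y) = f x + f y"
    "x \<in> S \<Longrightarrow> f (c *\<^sub>C x) = c *\<^sub>C f x" "x \<in> S \<Longrightarrow> f (r *\<^sub>R x) = r *\<^sub>R f x"
    "f \<in> extensional S"
  using assms by (auto simp: bounded_ops_def PiE_def scaleR_scaleC)

text \<open>Over the complex numbers a real-valued form forces symmetry, by polarization; conversely
  symmetry on a closed carrier supplies linearity and boundedness. Positivity becomes a statement to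
  which the real theory applies.\<close>

lemma pos_ops_iff:
  fixes S :: "'a::complex_hilbert set"
  assumes S: "csubspace S" "closed S"
  shows "f \<in> pos_ops S \<longleftrightarrow> f \<in> extensional S \<and> csymmetric_on S f \<and> (\<forall>x\<in>S. 0 \<le> inner (f x) x)"
proof
  assume f: "f \<in> pos_ops S"
  then have fb: "f \<in> bounded_ops S S" and "\<And>x. x \<in> S \<Longrightarrow> cinner (f x) x \<in> \<real>\<^sub>\<ge>\<^sub>0"
    by (auto simp: pos_ops_def)
  then have re: "0 \<le> inner (f x) x" and im: "inner (f x) (\<i> *\<^sub>C x) = 0" if "x \<in> S" for x
    using that unfolding Im_cinner[symmetric] by (auto simp: complex_nonneg_Reals_iff inner_eq_Re_cinner)
  \<comment> \<open>The imaginary part of the form vanishes at \<open>x\<close>, \<open>y\<close>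
    and \<open>x + y\<close>. The antisymmetry that remains becomes symmetry when \<open>y\<close>
    is replaced by minus i times \<open>y\<close>.\<close>
  have pol: "inner (f x) (\<i> *\<^sub>C y) = - inner (f y) (\<i> *\<^sub>C x)" if "x \<in> S" "y \<in> S" for x y
    using im[of "x + y"] im[of x] im[of y] that csubspaceD[OF S(1)]
    by (simp add: bounded_opsD[OF fb] scaleC_add_right inner_add_left inner_add_right)
  have sym: "inner (f x) y = inner x (f y)" if "x \<in> S" "y \<in> S" for x y
    using pol[of x "- (\<i> *\<^sub>C y)"] that csubspaceD[OF S(1)] bounded_opsD(3)[OF fb, of y "- \<i>"]
      bounded_opsD(4)[OF fb, of "\<i> *\<^sub>C y" "-1"] bounded_opsD(3)[OF fb, of y "\<i>"]
    by (simp add: scaleC_minus_right ii_ii inner_ii_left inner_commute)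
  have "csymmetric_on S f"
    by (rule symmetric_on_imp_csymmetric_on[OF S(1)])
      (auto simp: symmetric_on_def sym bounded_opsD[OF fb])
  then show "f \<in> extensional S \<and> csymmetric_on S f \<and> (\<forall>x\<in>S. 0 \<le> inner (f x) x)"
    using re bounded_opsD(5)[OF fb] by blast
next
  assume f: "f \<in> extensional S \<and> csymmetric_on S f \<and> (\<forall>x\<in>S. 0 \<le> inner (f x) x)"
  then have cs: "csymmetric_on S f" by blast
  have "restrict f S \<in> bounded_ops S S"
    by (rule adjoint_pair_bounded_ops[OF S S(1)]) (simp_all add: csymmetric_onD[OF cs])
  then have "f \<in> bounded_ops S S" using f by (simp add: extensional_restrict)
  moreover have "cinner (f x) x \<in> \<real>\<^sub>\<ge>\<^sub>0" if "x \<in> S" for x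
  proof -
    have "cnj (cinner (f x) x) = cinner (f x) x"
      using csymmetric_onD(3)[OF cs that that] cinner_commute by metis
    then have "Im (cinner (f x) x) = 0" by (simp add: complex_eq_iff)
    then show ?thesis using f that by (simp add: complex_nonneg_Reals_iff flip: inner_eq_Re_cinner)
  qed
  ultimately show "f \<in> pos_ops S" by (simp add: pos_ops_def)
qed

lemma restrict_pos_ops_iff:
  fixes S :: "'a::complex_hilbert set"
  assumes S: "csubspace S" "closed S"
  shows "restrict f S \<in> pos_ops S \<longleftrightarrow> csymmetric_on S f \<and> (\<forall>x\<in>S. 0 \<le> inner (f x) x)"
  using csymmetric_on_cong[of S "restrict f S" f] by (simp add: pos_ops_iff[OF S])

section \<open>Adjoints and inverses\<close>

lemma adj_op_eqI:
  assumes "csubspace S" "g \<in> bounded_ops T S"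
    "\<And>x y. x \<in> S \<Longrightarrow> y \<in> T \<Longrightarrow> cinner (f x) y = cinner x (g y)"
  shows "adj_op S T f = g"
  unfolding adj_op_def
proof (rule the_equality)
  fix k assume k: "k \<in> bounded_ops T S \<and> (\<forall>x\<in>S. \<forall>y\<in>T. cinner (f x) y = cinner x (k y))"
  show "k = g"
  proof (rule extensionalityI[of _ T])
    fix y assume y: "y \<in> T"
    show "k y = g y"
    proof (rule csubspace_cinner_eqI[OF assms(1)])
      fix z assume z: "z \<in> S"
      have "cinner z (k y) = cinner z (g y)" using k assms(3) y z by metis
      then show "cinner (k y) z = cinner (g y) z" using cinner_commute by metis
    qed (use k assms(2) y bounded_opsD in blast)+
  qed (use k assms(2) bounded_opsD(5) in blast)+
qed (use assms in blast)

text \<open>Riesz represents the real part of the functional, and its values at i times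
  \<open>x\<close> recover the imaginary part. The representing vectors are merely chosen; the
  adjoint relation makes them a bounded operator.\<close>

lemma adj_op_bounded_ops:
  fixes S :: "'a::complex_hilbert set" and T :: "'b::complex_hilbert set"
  assumes S: "csubspace S" "closed S" and T: "csubspace T" "closed T"
    and f: "f \<in> bounded_ops S T"
  shows "adj_op S T f \<in> bounded_ops T S"
    and "\<And>x y. x \<in> S \<Longrightarrow> y \<in> T \<Longrightarrow> cinner (f x) y = cinner x (adj_op S T f y)"
proof -
  obtain K where K: "\<And>x. x \<in> S \<Longrightarrow> norm (f x) \<le> K * norm x"
    using f unfolding bounded_ops_def by blast
  have "\<exists>p\<in>S. \<forall>x\<in>S. cinner (f x) y = cinner x p" if y: "y \<in> T" for y
  proof -
    obtain p where p: "p \<in> S" "\<And>x. x \<in> S \<Longrightarrow> inner (f x) y = inner p x"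
    proof (rule riesz_on_subspace[OF csubspaceD(1)[OF S(1)] S(2), of "\<lambda>x. inner (f x) y" "K * norm y"])
      show "\<bar>inner (f x) y\<bar> \<le> K * norm y * norm x" if "x \<in> S" for x
        using Cauchy_Schwarz_ineq2[of "f x" y] mult_right_mono[OF K[OF that] norm_ge_zero[of y]]
        by (simp add: mult_ac)
    qed (auto simp: bounded_opsD[OF f] inner_add_left)
    have "cinner (f x) y = cinner x p" if x: "x \<in> S" for x
    proof (rule cinner_eqI)
      show "inner (f x) y = inner x p" using p(2)[OF x] by (simp add: inner_commute)
      have "inner (f (\<i> *\<^sub>C x)) y = inner p (\<i> *\<^sub>C x)" by (rule p(2)) (simp add: csubspaceD[OF S(1)] x)
      then show "inner (f x) (\<i> *\<^sub>C y) = inner x (\<i> *\<^sub>C p)"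
        by (simp add: bounded_opsD[OF f] x inner_ii_left inner_commute[of p])
    qed
    then show ?thesis using p(1) by blast
  qed
  then obtain g where gS: "\<And>y. y \<in> T \<Longrightarrow> g y \<in> S"
    and g: "\<And>x y. y \<in> T \<Longrightarrow> x \<in> S \<Longrightarrow> cinner (f x) y = cinner x (g y)" by metis
  have "cinner (g y) x = cinner y (f x)" if "y \<in> T" "x \<in> S" for x y
    using g[OF that] cinner_commute by metis
  then have gb: "restrict g T \<in> bounded_ops T S"
    by (intro adjoint_pair_bounded_ops[OF T S(1)] gS)
  have "adj_op S T f = restrict g T" by (rule adj_op_eqI[OF S(1) gb]) (simp add: g)
  then show "adj_op S T f \<in> bounded_ops T S"
    "\<And>x y. x \<in> S \<Longrightarrow> y \<in> T \<Longrightarrow> cinner (f x) y = cinner x (adj_op S T f y)"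
    using gb g by simp_all
qed

lemma inv_op_bij:
  assumes "bij_betw f S S" "x \<in> S"
  shows "inv_op S f x \<in> S" "f (inv_op S f x) = x" "inv_op S f (f x) = x"
  using assms by (auto simp: inv_op_def bij_betw_def inv_into_into f_inv_into_f)

lemma inv_op_eqI:
  assumes "inj_on f S" "y \<in> S" "f y = x" "x \<in> S"
  shows "inv_op S f x = y"
  using assms by (auto simp: inv_op_def)

lemma csymmetric_on_inv_op:
  assumes "csymmetric_on S f" "bij_betw f S S"
  shows "csymmetric_on S (inv_op S f)"
  unfolding csymmetric_on_def
proof (intro conjI ballI)
  show "cinner (inv_op S f x) y = cinner x (inv_op S f y)" if "x \<in> S" "y \<in> S" for x y
    using csymmetric_onD(3)[OF assms(1), of "inv_op S f x" "inv_op S f y"] inv_op_bij[OF assms(2)] that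
    by simp
qed (use inv_op_bij[OF assms(2)] in auto)

text \<open>Vectors with the same image differ by something orthogonal to the range, here all of
  \<open>S\<close>.\<close>

lemma csymmetric_on_surj_imp_bij:
  assumes S: "csubspace S" and f: "csymmetric_on S f" and surj: "f ` S = S"
  shows "bij_betw f S S"
proof -
  have "x = y" if "x \<in> S" "y \<in> S" "f x = f y" for x y
  proof (rule csubspace_cinner_eqI[OF S that(1,2)])
    fix z assume "z \<in> S"
    then obtain w where "w \<in> S" "z = f w" using surj by blast
    then show "cinner x z = cinner y z" using csymmetric_onD(3)[OF f] that by metis
  qed
  then show ?thesis using surj by (auto simp: bij_betw_def inj_on_def)
qed

text \<open>Cauchy-Schwarz for the form of \<open>f\<close> between \<open>x\<close> and
  \<open>f^-1 x\<close>: the mixed term is the squared norm of \<open>x\<close>, so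
  \<open>c = 1 / k\<close> works, with \<open>k\<close> a bound of the inverse.\<close>

lemma positive_bij_coercive:
  fixes f :: "'a::complex_hilbert \<Rightarrow> 'a"
  assumes S: "csubspace S" "closed S" and f: "csymmetric_on S f" and bij: "bij_betw f S S"
    and pos: "\<And>x. x \<in> S \<Longrightarrow> 0 \<le> inner (f x) x"
  obtains c where "c > 0" "\<And>x. x \<in> S \<Longrightarrow> c * (norm x)\<^sup>2 \<le> inner (f x) x"
proof -
  note sub = csubspaceD(1)[OF S(1)]
  let ?g = "inv_op S f"
  have g: "symmetric_on S ?g" using csymmetric_onD(1)[OF csymmetric_on_inv_op[OF f bij]] .
  obtain k where k: "k > 0" "\<And>x. x \<in> S \<Longrightarrow> norm (?g x) \<le> k * norm x"
    using symmetric_on_bounded[OF sub S(2) g] by blast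
  have "1 / k * (norm x)\<^sup>2 \<le> inner (f x) x" if x: "x \<in> S" for x
  proof (cases "x = 0")
    case False
    have gx: "?g x \<in> S" "f (?g x) = x" using inv_op_bij[OF bij x] by auto
    have "(inner (f x) (?g x))\<^sup>2 \<le> inner (f x) x * inner (f (?g x)) (?g x)"
      by (rule symmetric_on_Cauchy_Schwarz[OF sub csymmetric_onD(1)[OF f] pos x gx(1)])
    moreover have "inner (f x) (?g x) = (norm x)\<^sup>2"
      using symmetric_onD(2)[OF csymmetric_onD(1)[OF f] x gx(1)] gx(2) by (simp add: power2_norm_eq_inner)
    moreover have "inner (f (?g x)) (?g x) \<le> k * (norm x)\<^sup>2"
      using inner_le_of_norm_le[OF k(2)[OF x]] gx(2) by (simp add: inner_commute)
    ultimately have "((norm x)\<^sup>2)\<^sup>2 \<le> inner (f x) x * (k * (norm x)\<^sup>2)"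
      using pos[OF x] by (metis mult_left_mono order_trans)
    then have "(norm x)\<^sup>2 * (norm x)\<^sup>2 \<le> (k * inner (f x) x) * (norm x)\<^sup>2"
      by (simp only: power2_eq_square[of "(norm x)\<^sup>2"] mult_ac)
    moreover have "(norm x)\<^sup>2 > 0" using False by simp
    ultimately have "(norm x)\<^sup>2 \<le> k * inner (f x) x" by (rule mult_right_le_imp_le)
    then show ?thesis using k(1) by (simp add: field_simps)
  qed simp
  then show ?thesis using k(1) by (intro that[of "1 / k"]) simp_all
qed

section \<open>Orthogonal projections and extension by the identity\<close>

lemma orth_proj_eqI:
  assumes S: "csubspace S" and p: "p \<in> S" "\<And>z. z \<in> S \<Longrightarrow> cinner (x - p) z = 0"
  shows "orth_proj S x = p"
  unfolding orth_proj_def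
proof (rule the_equality)
  fix p' assume p': "p' \<in> S \<and> (\<forall>z\<in>S. cinner (x - p') z = 0)"
  show "p' = p"
  proof (rule csubspace_cinner_eqI[OF S _ p(1)])
    show "cinner p' z = cinner p z" if "z \<in> S" for z
      using p(2)[OF that] p' that by (simp add: cinner_diff_left)
  qed (use p' in blast)
qed (use p in blast)

lemma orth_proj:
  fixes S :: "'a::complex_hilbert set"
  assumes S: "csubspace S" "closed S"
  shows "orth_proj S x \<in> S" "z \<in> S \<Longrightarrow> cinner (x - orth_proj S x) z = 0"
proof -
  obtain p where p: "p \<in> S" "\<And>z. z \<in> S \<Longrightarrow> inner (x - p) z = 0"
    using orthogonal_projection_exists[OF csubspaceD(1)[OF S(1)] S(2)] by metis
  have c: "cinner (x - p) z = 0" if "z \<in> S" for z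
    using p(2)[OF that] p(2)[OF csubspaceD(2)[OF S(1) that, of \<i>]]
    by (simp add: complex_eq_iff Im_cinner) (simp add: inner_eq_Re_cinner)
  have "orth_proj S x = p" by (rule orth_proj_eqI[OF S(1) p(1) c])
  then show "orth_proj S x \<in> S" "z \<in> S \<Longrightarrow> cinner (x - orth_proj S x) z = 0"
    using p(1) c by simp_all
qed

lemma orth_proj_id: "csubspace S \<Longrightarrow> x \<in> S \<Longrightarrow> orth_proj S x = x"
  by (rule orth_proj_eqI) simp_all

lemma csymmetric_on_orth_proj:
  fixes S :: "'a::complex_hilbert set"
  assumes S: "csubspace S" "closed S"
  shows "csymmetric_on UNIV (orth_proj S)"
proof -
  have "cinner (orth_proj S x) y = cinner x (orth_proj S y)" for x y
  proof -
    have "cinner (x - orth_proj S x) (orth_proj S y) = 0" "cinner (y - orth_proj S y) (orth_proj S x) = 0"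
      by (simp_all add: orth_proj[OF S])
    moreover have "cinner (orth_proj S x) (y - orth_proj S y) = cnj (cinner (y - orth_proj S y) (orth_proj S x))"
      by (rule cinner_commute)
    ultimately show ?thesis by (simp add: cinner_simps)
  qed
  then show ?thesis by (simp add: csymmetric_on_def)
qed

lemma csymmetric_on_scaleC:
  assumes "csubspace S" "csymmetric_on S f" "x \<in> S"
  shows "f (c *\<^sub>C x) = c *\<^sub>C f x"
  using assms
  by (intro csubspace_cinner_eqI[OF assms(1)]) (simp_all add: csymmetric_onD csubspaceD cinner_scaleC_left)

lemma csymmetric_on_extend:
  fixes S :: "'a::complex_hilbert set"
  assumes S: "csubspace S" "closed S" and f: "csymmetric_on S f"
    and c: "c > 0" "\<And>x. x \<in> S \<Longrightarrow> c * (norm x)\<^sup>2 \<le> inner (f x) x"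
  defines "F \<equiv> \<lambda>x. f (orth_proj S x) + (x - orth_proj S x)"
  shows "csymmetric_on UNIV F" "min c 1 * (norm x)\<^sup>2 \<le> inner (F x) x"
    "orth_proj S (F x) = F (orth_proj S x)"
proof -
  let ?P = "orth_proj S"
  note P = orth_proj[OF S]
  note Psym = csymmetric_onD(3)[OF csymmetric_on_orth_proj[OF S], simplified]
  have fP: "f (?P x) \<in> S" for x using csymmetric_onD(2)[OF f] P(1) by blast
  have PP: "?P (?P x) = ?P x" for x by (rule orth_proj_id[OF S(1) P(1)])
  have PfP: "?P (f (?P x)) = f (?P x)" for x by (rule orth_proj_id[OF S(1) fP])
  have fsym: "cinner (f (?P x)) y = cinner x (f (?P y))" for x y
    using csymmetric_onD(3)[OF f P(1) P(1)] Psym PfP by metis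
  show "csymmetric_on UNIV F"
    by (simp add: csymmetric_on_def F_def cinner_simps Psym fsym)
  have Padd: "?P (x + y) = ?P x + ?P y" for x y
    using symmetric_on_add[OF subspace_UNIV csymmetric_onD(1)[OF csymmetric_on_orth_proj[OF S]]] by simp
  have f0: "f 0 = 0"
    using symmetric_on_scale[OF csubspaceD(1)[OF S(1)] csymmetric_onD(1)[OF f] csubspaceD(7)[OF S(1)], of 0]
    by simp
  have Pd: "?P (x - ?P x) = 0"
    by (rule orth_proj_eqI[OF S(1)]) (simp_all add: csubspaceD[OF S(1)] P)
  show "?P (F x) = F (?P x)" by (simp add: F_def Padd PfP PP Pd)
  define u where "u = ?P x"
  define v where "v = x - ?P x"
  have uS: "u \<in> S" by (simp add: u_def P)
  have orth: "inner v z = 0" if "z \<in> S" for z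
    using P(2)[OF that] by (simp add: v_def inner_eq_Re_cinner)
  have x: "x = u + v" by (simp add: u_def v_def)
  have "inner (F x) x = inner (f u) u + (norm v)\<^sup>2"
    using orth[OF uS] orth[OF csymmetric_onD(2)[OF f uS]]
    by (simp add: F_def flip: u_def v_def) (simp add: x inner_add_left inner_add_right
        power2_norm_eq_inner inner_commute)
  moreover have "(norm x)\<^sup>2 = (norm u)\<^sup>2 + (norm v)\<^sup>2"
    using orth[OF uS] by (simp add: x power2_norm_eq_inner inner_add_left inner_add_right inner_commute)
  moreover have "min c 1 * (norm u)\<^sup>2 \<le> c * (norm u)\<^sup>2" "min c 1 * (norm v)\<^sup>2 \<le> 1 * (norm v)\<^sup>2"
    by (intro mult_right_mono; simp)+
  ultimately show "min c 1 * (norm x)\<^sup>2 \<le> inner (F x) x"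
    using c(2)[OF uS] by (simp add: distrib_left)
qed

subsection \<open>The geometric mean\<close>

text \<open>With \<open>Q = a\<^sup>1\<^sup>/\<^sup>2\<close> the solution is \<open>M = Q (Q\<^sup>-\<^sup>1 C Q\<^sup>-\<^sup>1)\<^sup>1\<^sup>/\<^sup>2 Q\<close>. The square roots are taken on the
  whole space, after extending \<open>a\<close> and \<open>C\<close> by the identity; they commute with the projection onto \<open>S\<close>
  and with multiplication by \<open>\<i>\<close> because \<open>a\<close> and \<open>C\<close> do.\<close>

lemma riccati_solution_exists:
  fixes S :: "'a::complex_hilbert set"
  assumes S: "csubspace S" "closed S"
    and a: "csymmetric_on S a" and c: "c > 0" "\<And>x. x \<in> S \<Longrightarrow> c * (norm x)\<^sup>2 \<le> inner (a x) x"
    and C: "csymmetric_on S C" and d: "d > 0" "\<And>x. x \<in> S \<Longrightarrow> d * (norm x)\<^sup>2 \<le> inner (C x) x"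
  obtains M where "M \<in> pos_ops S" "\<And>x. x \<in> S \<Longrightarrow> M (inv_op S a (M x)) = C x"
proof -
  let ?P = "orth_proj S"
  note P = orth_proj[OF S]
  define A where "A x = a (?P x) + (x - ?P x)" for x
  define D where "D x = C (?P x) + (x - ?P x)" for x
  note Aext = csymmetric_on_extend[OF S a c, folded A_def[abs_def], unfolded A_def[symmetric]]
  note Dext = csymmetric_on_extend[OF S C d, folded D_def[abs_def], unfolded D_def[symmetric]]
  have Aeq: "A x = a x" and Deq: "D x = C x" if "x \<in> S" for x
    using that by (simp_all add: A_def D_def orth_proj_id[OF S(1)])
  have mc: "min c 1 > 0" and md: "min d 1 > 0" using c d by auto
  note Asym = csymmetric_onD(1)[OF Aext(1)] note Dsym = csymmetric_onD(1)[OF Dext(1)]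
  obtain Q q where Q: "symmetric_on UNIV Q" "q > 0" "\<And>x. q * (norm x)\<^sup>2 \<le> inner (Q x) x"
    "\<And>x. Q (Q x) = A x"
    "\<And>J x. bounded_linear J \<Longrightarrow> (\<And>x. J (A x) = A (J x)) \<Longrightarrow> J (Q x) = Q (J x)"
    using symmetric_coercive_sqrt[OF Asym mc Aext(2)] by blast
  have bijQ: "bij Q"
    using symmetric_on_coercive_surj[OF subspace_UNIV closed_UNIV Q(1,2)] Q(3) by simp
  define R where "R = inv Q"
  have QR: "Q (R x) = x" and RQ: "R (Q x) = x" for x
    using bijQ by (simp_all add: R_def surj_f_inv_f bij_is_surj inv_f_f bij_is_inj)
  have Qsym: "inner (Q x) y = inner x (Q y)" for x y using symmetric_onD(2)[OF Q(1)] by simp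
  have Rsym: "inner (R x) y = inner x (R y)" for x y using Qsym[of "R x" "R y"] by (simp add: QR)
  have Dsym': "inner (D x) y = inner x (D y)" for x y using symmetric_onD(2)[OF Dsym] by simp
  \<comment> \<open>Since \<open>k\<close> bounds \<open>Q\<close>, its inverse \<open>R\<close>
    shrinks norms at most by the factor \<open>k\<close>; this is the origin of the coercivity
    constant \<open>min d 1 / k^2\<close>.\<close>
  define T where "T x = R (D (R x))" for x
  have Tsym: "symmetric_on UNIV T" by (simp add: symmetric_on_def T_def Rsym Dsym')
  obtain k where k: "k > 0" "\<And>x. norm (Q x) \<le> k * norm x"
    using symmetric_on_bounded[OF subspace_UNIV closed_UNIV Q(1)] by auto
  have Tco: "min d 1 / k\<^sup>2 * (norm x)\<^sup>2 \<le> inner (T x) x" for x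
  proof -
    have "(norm x)\<^sup>2 \<le> (k * norm (R x))\<^sup>2" using k(2)[of "R x"] by (simp add: QR power_mono)
    then have "(norm x)\<^sup>2 / k\<^sup>2 \<le> (norm (R x))\<^sup>2" using k(1) by (simp add: field_simps)
    then have "min d 1 * ((norm x)\<^sup>2 / k\<^sup>2) \<le> min d 1 * (norm (R x))\<^sup>2"
      using md by (intro mult_left_mono) auto
    also have "\<dots> \<le> inner (D (R x)) (R x)" by (rule Dext(2))
    also have "\<dots> = inner (T x) x" by (simp add: T_def Rsym)
    finally show ?thesis by simp
  qed
  have tk: "min d 1 / k\<^sup>2 > 0" using md k by simp
  obtain F f where F: "symmetric_on UNIV F" "f > 0" "\<And>x. f * (norm x)\<^sup>2 \<le> inner (F x) x"
    "\<And>x. F (F x) = T x"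
    "\<And>J x. bounded_linear J \<Longrightarrow> (\<And>x. J (T x) = T (J x)) \<Longrightarrow> J (F x) = F (J x)"
    using symmetric_coercive_sqrt[OF Tsym tk Tco] by blast
  have Fsym: "inner (F x) y = inner x (F y)" for x y using symmetric_onD(2)[OF F(1)] by simp
  define M where "M x = Q (F (Q x))" for x
  have Msym: "inner (M x) y = inner x (M y)" for x y by (simp add: M_def Qsym Fsym)
  \<comment> \<open>Commutation passes from \<open>A\<close> to \<open>Q\<close> and
    \<open>R\<close>, then to \<open>T\<close>, \<open>F\<close> and \<open>M\<close>. The
    projection as \<open>J\<close> shows that \<open>M\<close> preserves \<open>S\<close>; the
    imaginary unit as \<open>J\<close> gives complex linearity.\<close>
  have comm: "J (M x) = M (J x)"
    if J: "bounded_linear J" "\<And>x. J (A x) = A (J x)" "\<And>x. J (D x) = D (J x)" for J x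
  proof -
    have JQ: "J (Q x) = Q (J x)" for x by (rule Q(5)[OF J(1,2)])
    have JR: "J (R x) = R (J x)" for x by (metis JQ QR RQ)
    have "J (F x) = F (J x)" for x by (rule F(5)[OF J(1)]) (simp add: T_def JR J(3))
    then show ?thesis by (simp add: M_def JQ)
  qed
  have "?P (M x) = M (?P x)" for x
    using symmetric_on_UNIV_bounded_linear[OF csymmetric_onD(1)[OF csymmetric_on_orth_proj[OF S]]]
    by (rule comm) (simp_all add: Aext(3) Dext(3))
  then have MS: "M x \<in> S" if "x \<in> S" for x by (metis P(1) orth_proj_id[OF S(1) that])
  have Mi: "M (\<i> *\<^sub>C x) = \<i> *\<^sub>C M x" for x
    by (rule comm[OF bounded_linear_ii, symmetric])
      (simp_all add: csymmetric_on_scaleC[OF csubspace_UNIV] Aext(1) Dext(1))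
  have Mcs: "csymmetric_on S M"
    by (rule symmetric_on_imp_csymmetric_on[OF S(1)]) (auto simp: symmetric_on_def MS Msym Mi)
  have "0 \<le> inner (M x) x" for x
  proof -
    have "0 \<le> f * (norm (Q x))\<^sup>2" using F(2) by simp
    also have "\<dots> \<le> inner (M x) x" using F(3)[of "Q x"] by (simp add: M_def Qsym)
    finally show ?thesis .
  qed
  then have "restrict M S \<in> pos_ops S" using Mcs by (simp add: restrict_pos_ops_iff[OF S])
  moreover have "restrict M S (inv_op S a (restrict M S x)) = C x" if x: "x \<in> S" for x
  proof -
    have bij: "bij_betw a S S"
      by (rule symmetric_on_coercive_surj[OF csubspaceD(1)[OF S(1)] S(2) csymmetric_onD(1)[OF a] c])
    define w where "w = inv_op S a (M x)"
    have w: "w \<in> S" "a w = M x" using inv_op_bij[OF bij MS[OF x]] by (simp_all add: w_def)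
    then have "Q (Q w) = Q (F (Q x))" using Aeq[OF w(1)] Q(4) by (simp add: M_def)
    then have "Q w = F (Q x)" by (metis RQ)
    then have "M w = Q (T (Q x))" using F(4) by (simp add: M_def)
    also have "\<dots> = D x" by (simp add: T_def QR RQ)
    also have "\<dots> = C x" by (rule Deq[OF x])
    finally show ?thesis using w x by (simp add: w_def)
  qed
  ultimately show ?thesis by (rule that)
qed

text \<open>Completing the square in the second variable turns block positivity into
  \<open>X a^-1 X <= C\<close>. \<open>M\<close> attains equality, and since the quadratic map
  reflects order, every competitor lies below \<open>M\<close>.\<close>

lemma geo_mean_eqI:
  fixes S :: "'a::complex_hilbert set"
  assumes S: "csubspace S" "closed S"
    and a: "a \<in> pos_ops S" and surj: "a ` S = S"
    and M: "M \<in> pos_ops S" and C: "\<And>x. x \<in> S \<Longrightarrow> C x = M (inv_op S a (M x))"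
  shows "geo_mean S C a = M"
proof -
  note sub = csubspaceD(1)[OF S(1)]
  have SS: "csubspace (S \<times> S)" "closed (S \<times> S)"
    by (simp_all add: csubspace_Times S closed_Times)
  let ?ai = "inv_op S a"
  have acs: "csymmetric_on S a" and apos: "\<And>x. x \<in> S \<Longrightarrow> 0 \<le> inner (a x) x"
    using a by (simp_all add: pos_ops_iff[OF S])
  have Mcs: "csymmetric_on S M" and Mpos: "\<And>x. x \<in> S \<Longrightarrow> 0 \<le> inner (M x) x" and Mext: "M \<in> extensional S"
    using M by (simp_all add: pos_ops_iff[OF S])
  have bij: "bij_betw a S S" by (rule csymmetric_on_surj_imp_bij[OF S(1) acs surj])
  note ai = inv_op_bij[OF bij]
  have aics: "csymmetric_on S ?ai" by (rule csymmetric_on_inv_op[OF acs bij])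
  obtain c where c: "c > 0" "\<And>x. x \<in> S \<Longrightarrow> c * (norm x)\<^sup>2 \<le> inner (a x) x"
    using positive_bij_coercive[OF S acs bij apos] by blast
  note asym = symmetric_onD(2)[OF csymmetric_onD(1)[OF acs]]
  note Msym = symmetric_onD(2)[OF csymmetric_onD(1)[OF Mcs]]
  note MS = csymmetric_onD(2)[OF Mcs] note aS = csymmetric_onD(2)[OF acs]
  have CS: "C x \<in> S" if "x \<in> S" for x using C[OF that] MS ai(1) that by simp
  have Csym: "cinner (C x) y = cinner x (C y)" if "x \<in> S" "y \<in> S" for x y
    using that by (simp add: C csymmetric_onD[OF Mcs] csymmetric_onD[OF aics])
  have Cq: "inner (C x) x = inner (M x) (?ai (M x))" if "x \<in> S" for x
    using that by (simp add: C Msym MS ai inner_commute)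
  have block: "dsum_op S C X X a \<in> pos_ops (S \<times> S) \<longleftrightarrow>
      (\<forall>u\<in>S. \<forall>v\<in>S. 0 \<le> inner (C u) u + 2 * inner (X u) v + inner (a v) v)"
    if X: "csymmetric_on S X" for X
  proof -
    have "cinner (C u + X v, X u + a v) (u', v') = cinner (u, v) (C u' + X v', X u' + a v')"
      if "u \<in> S" "v \<in> S" "u' \<in> S" "v' \<in> S" for u v u' v'
      using that by (simp add: cinner_prod_def cinner_simps Csym csymmetric_onD[OF X] csymmetric_onD[OF acs])
    then have "csymmetric_on (S \<times> S) (\<lambda>(u, v). (C u + X v, X u + a v))"
      by (auto simp: csymmetric_on_def csubspaceD[OF S(1)] CS csymmetric_onD(2)[OF X] aS)
    moreover have "inner (C u + X v, X u + a v) (u, v) = inner (C u) u + 2 * inner (X u) v + inner (a v) v"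
      if "u \<in> S" "v \<in> S" for u v
      using symmetric_onD(2)[OF csymmetric_onD(1)[OF X] that]
      by (simp add: inner_prod_def inner_add_left inner_commute[of "X v" u])
    ultimately show ?thesis
      unfolding dsum_op_def by (auto simp: restrict_pos_ops_iff[OF SS])
  qed
  have MG: "M \<in> geo_mean_set S C a"
    unfolding geo_mean_set_def mem_Collect_eq block[OF Mcs]
  proof (intro conjI M ballI)
    fix u v assume u: "u \<in> S" and v: "v \<in> S"
    define w where "w = ?ai (M u)"
    have w: "w \<in> S" "a w = M u" using ai MS[OF u] by (simp_all add: w_def)
    have "0 \<le> inner (a (w + v)) (w + v)" using apos w v csubspaceD[OF S(1)] by blast
    also have "\<dots> = inner (a w) w + 2 * inner (a w) v + inner (a v) v"
      using asym[OF v w(1)] symmetric_on_add[OF sub csymmetric_onD(1)[OF acs] w(1) v]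
      by (simp add: inner_add_left inner_add_right inner_commute)
    finally show "0 \<le> inner (C u) u + 2 * inner (M u) v + inner (a v) v"
      using Cq[OF u] w by (simp add: w_def)
  qed
  have max: "loewner_le S X M" if XG: "X \<in> geo_mean_set S C a" for X
  proof -
    have Xp: "X \<in> pos_ops S" and Xb: "dsum_op S C X X a \<in> pos_ops (S \<times> S)"
      using XG by (auto simp: geo_mean_set_def)
    have Xcs: "csymmetric_on S X" using Xp by (simp add: pos_ops_iff[OF S])
    have "inner (X u) (?ai (X u)) \<le> inner (M u) (?ai (M u))" if u: "u \<in> S" for u
    proof -
      define w where "w = ?ai (X u)"
      have w: "w \<in> S" "a w = X u" using ai csymmetric_onD(2)[OF Xcs u] by (simp_all add: w_def)
      have aw: "a (- w) = - a w"
        using symmetric_on_scale[OF sub csymmetric_onD(1)[OF acs] w(1), of "-1"] by simp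
      \<comment> \<open>For fixed \<open>u\<close>, the vector \<open>- w\<close> minimizes the
        block form in its second variable.\<close>
      have "0 \<le> inner (C u) u + 2 * inner (X u) (- w) + inner (a (- w)) (- w)"
        using Xb u w(1) csubspaceD(6)[OF S(1) w(1)] unfolding block[OF Xcs] by blast
      then show ?thesis using Cq[OF u] by (simp add: aw w(2) flip: w_def)
    qed
    then have "inner (X u) u \<le> inner (M u) u" if "u \<in> S" for u
      using that
      by (intro riccati_order_reflecting[OF sub S(2) csymmetric_onD(1)[OF acs] csymmetric_onD(1)[OF aics]
            ai(3) c csymmetric_onD(1)[OF Mcs] Mpos csymmetric_onD(1)[OF Xcs]])
    then show ?thesis
      unfolding loewner_le_def restrict_pos_ops_iff[OF S]
      by (auto simp: csymmetric_on_def csubspaceD[OF S(1)] csymmetric_onD[OF Mcs] csymmetric_onD[OF Xcs]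
          cinner_simps inner_diff_left)
  qed
  show ?thesis
    unfolding geo_mean_def
  proof (rule the_equality)
    fix X assume X: "X \<in> geo_mean_set S C a \<and> (\<forall>Y\<in>geo_mean_set S C a. loewner_le S Y X)"
    then have Xp: "X \<in> pos_ops S" by (simp add: geo_mean_set_def)
    have D1: "csymmetric_on S (\<lambda>x. M x - X x)" "\<And>x. x \<in> S \<Longrightarrow> 0 \<le> inner (M x - X x) x"
      using max X unfolding loewner_le_def restrict_pos_ops_iff[OF S] by blast+
    have D2: "\<And>x. x \<in> S \<Longrightarrow> 0 \<le> inner (X x - M x) x"
      using MG X unfolding loewner_le_def restrict_pos_ops_iff[OF S] by blast
    show "X = M"
    proof (rule extensionalityI[of _ S])
      show "X \<in> extensional S" using Xp by (simp add: pos_ops_iff[OF S])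
      fix x assume x: "x \<in> S"
      have "inner (M x - X x) x = 0" using D1(2)[OF x] D2[OF x] by (simp add: inner_diff_left)
      moreover have dS: "M x - X x \<in> S" using csymmetric_onD(2)[OF D1(1) x] .
      \<comment> \<open>A positive operator whose form vanishes at \<open>x\<close> annihilates
        \<open>x\<close>, by Cauchy-Schwarz against the image itself.\<close>
      ultimately have "(inner (M x - X x) (M x - X x))\<^sup>2 \<le> 0"
        using symmetric_on_Cauchy_Schwarz[OF sub csymmetric_onD(1)[OF D1(1)] D1(2) x dS] by simp
      then show "X x = M x" by simp
    qed (rule Mext)
  qed (use MG max in blast)
qed

subsection \<open>Block operators and the diamond order\<close>

definition orth_decomp :: "'a::complex_hilbert set \<Rightarrow> 'a set \<Rightarrow> bool" where
  "orth_decomp R N \<longleftrightarrow> csubspace R \<and> closed R \<and> csubspace N \<and> closed N \<and>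
     (\<forall>u\<in>R. \<forall>v\<in>N. cinner u v = 0) \<and> (\<forall>x. x - orth_proj R x \<in> N)"

lemma orth_decompD:
  assumes "orth_decomp R N"
  shows "csubspace R" "closed R" "csubspace N" "closed N"
    "u \<in> R \<Longrightarrow> v \<in> N \<Longrightarrow> cinner u v = 0" "u \<in> R \<Longrightarrow> v \<in> N \<Longrightarrow> cinner v u = 0"
    "x - orth_proj R x \<in> N" "orth_proj R x \<in> R"
    "u \<in> R \<Longrightarrow> u \<in> N \<Longrightarrow> u = 0"
proof -
  show *: "u \<in> R \<Longrightarrow> v \<in> N \<Longrightarrow> cinner u v = 0" for u v
    using assms by (auto simp: orth_decomp_def)
  then show "u \<in> R \<Longrightarrow> v \<in> N \<Longrightarrow> cinner v u = 0" using cinner_commute[of v u] by simp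
  show "u \<in> R \<Longrightarrow> u \<in> N \<Longrightarrow> u = 0"
    using *[of u u] inner_eq_Re_cinner[of u u] by simp
qed (use assms in \<open>auto simp: orth_decomp_def orth_proj\<close>)

lemma block_op_add:
  assumes RN: "orth_decomp R N" and "u \<in> R" "v \<in> N"
  shows "block_op R N f11 f12 f21 f22 (u + v) = (f11 u + f12 v) + (f21 u + f22 v)"
proof -
  have "orth_proj R (u + v) = u"
    using assms(2,3) by (intro orth_proj_eqI) (simp_all add: orth_decompD[OF RN])
  moreover have "orth_proj N (u + v) = v"
    using assms(2,3) by (intro orth_proj_eqI) (simp_all add: orth_decompD[OF RN])
  ultimately show ?thesis by (simp add: block_op_def)
qed

lemma eq_block_op_iff:
  assumes RN: "orth_decomp R N"
  shows "B = block_op R N f11 f12 f21 f22 \<longleftrightarrow>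
    (\<forall>u\<in>R. \<forall>v\<in>N. B (u + v) = (f11 u + f12 v) + (f21 u + f22 v))"
proof
  assume eq: "\<forall>u\<in>R. \<forall>v\<in>N. B (u + v) = (f11 u + f12 v) + (f21 u + f22 v)"
  show "B = block_op R N f11 f12 f21 f22"
  proof
    fix x
    have "x = orth_proj R x + (x - orth_proj R x)" by simp
    then show "B x = block_op R N f11 f12 f21 f22 x"
      using eq block_op_add[OF RN orth_decompD(8,7)[OF RN]] orth_decompD(7,8)[OF RN] by metis
  qed
qed (simp add: block_op_add[OF RN])

text \<open>The nullspace of a symmetric operator is the orthogonal complement of its range, and
  closedness of the range provides the projection.\<close>

lemma nullspace_orth_decomp:
  fixes A :: "'h::complex_hilbert \<Rightarrow> 'h"
  assumes A: "csymmetric_on UNIV A" and cl: "closed (range A)"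
  shows "orth_decomp (range A) (nullspace A)"
proof -
  note sym = csymmetric_onD(3)[OF A, simplified]
  have add: "A (x + y) = A x + A y" and scale: "A (r *\<^sub>R x) = r *\<^sub>R A x" for x y r
    using symmetric_on_add[OF subspace_UNIV csymmetric_onD(1)[OF A]]
      symmetric_on_scale[OF subspace_UNIV csymmetric_onD(1)[OF A]] by simp_all
  have scaleC: "A (c *\<^sub>C x) = c *\<^sub>C A x" for c x
    using csymmetric_on_scaleC[OF csubspace_UNIV A] by simp
  have lin: "linear A" by (simp add: linear_iff add scale)
  have R: "csubspace (range A)"
    unfolding csubspace_def using linear_subspace_image[OF lin subspace_UNIV]
    by (auto simp flip: scaleC)
  have scaleC0: "c *\<^sub>C (0::'h) = 0" for c using scaleC_scaleR_commute[of c 0 0] by simp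
  have N: "csubspace (nullspace A)"
    using scale[of 0 0] by (auto simp: csubspace_def subspace_def nullspace_def add scale scaleC scaleC0)
  have "continuous_on UNIV A"
    using symmetric_on_UNIV_bounded_linear[OF csymmetric_onD(1)[OF A]]
    by (rule linear_continuous_on)
  then have "closed (nullspace A)"
    unfolding nullspace_def by (intro closed_Collect_eq continuous_on_const)
  moreover have "cinner u v = 0" if "u \<in> range A" "v \<in> nullspace A" for u v
    using that by (auto simp: sym nullspace_def)
  moreover have "x - orth_proj (range A) x \<in> nullspace A" for x
  proof -
    have "A (x - orth_proj (range A) x) = 0"
    proof (rule csubspace_cinner_eqI[OF csubspace_UNIV UNIV_I UNIV_I])
      show "cinner (A (x - orth_proj (range A) x)) z = cinner 0 z" for z
        using orth_proj(2)[OF R cl] by (simp add: sym)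
    qed
    then show ?thesis by (simp add: nullspace_def)
  qed
  ultimately show ?thesis using R N cl by (simp add: orth_decomp_def)
qed

text \<open>In operator notation \<open>G = P a^-1\<close>, so \<open>G^-1 = a P^-1\<close>; as
  \<open>a\<close> and \<open>P\<close> are symmetric, the adjoint is \<open>a^-1 P\<close>, with
  inverse \<open>P^-1 a\<close>.\<close>

lemma inv_op_factor:
  fixes S :: "'a::complex_hilbert set"
  assumes S: "csubspace S" "closed S"
    and a: "csymmetric_on S a" "bij_betw a S S" and P: "csymmetric_on S P" "bij_betw P S S"
    and G: "\<And>x. x \<in> S \<Longrightarrow> G x = P (inv_op S a x)" and x: "x \<in> S"
  shows "inv_op S G x = a (inv_op S P x)"
    and "inv_op S (adj_op S S G) x = inv_op S P (a x)"
proof -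
  note ai = inv_op_bij[OF a(2)] note Pi = inv_op_bij[OF P(2)]
  note aS = csymmetric_onD(2)[OF a(1)] note PS = csymmetric_onD(2)[OF P(1)]
  have "inj_on G S"
    by (rule inj_onI) (metis G ai Pi(3))
  then show "inv_op S G x = a (inv_op S P x)"
    using x by (intro inv_op_eqI) (simp_all add: G ai Pi aS)
  have aics: "csymmetric_on S (inv_op S a)" by (rule csymmetric_on_inv_op[OF a])
  have "restrict (\<lambda>x. inv_op S a (P x)) S \<in> bounded_ops S S"
    by (rule adjoint_pair_bounded_ops[OF S S(1), of _ "\<lambda>x. P (inv_op S a x)"])
      (simp_all add: ai PS csymmetric_onD[OF aics] csymmetric_onD[OF P(1)])
  then have adj: "adj_op S S G = restrict (\<lambda>x. inv_op S a (P x)) S"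
    by (rule adj_op_eqI[OF S(1)]) (simp add: G ai PS csymmetric_onD(3)[OF aics] csymmetric_onD(3)[OF P(1)])
  have "inj_on (restrict (\<lambda>x. inv_op S a (P x)) S) S"
    by (rule inj_onI) (metis restrict_apply' PS ai(2) Pi(3))
  then show "inv_op S (adj_op S S G) x = inv_op S P (a x)"
    unfolding adj using x by (intro inv_op_eqI) (simp_all add: ai Pi aS)
qed

text \<open>Both directions meet here: once \<open>P - a/2\<close> is recognized as the geometric
  mean, the mean and \<open>G\<close> disappear and only \<open>P\<close> remains in the blocks. The
  recognition is the expansion \<open>(P - a/2) a^-1 (P - a/2) = P a^-1 P - P + a/4\<close>.\<close>

lemma block_condition_iff:
  fixes R N :: "'h::complex_hilbert set"
  assumes RN: "orth_decomp R N" and a: "a \<in> pos_ops R" "a ` R = R"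
    and P: "csymmetric_on R P" "bij_betw P R R"
    and M: "\<And>u. u \<in> R \<Longrightarrow> 0 \<le> inner (P u - (1/2) *\<^sub>R a u) u"
    and ric: "\<And>u. u \<in> R \<Longrightarrow> P (inv_op R a (P u)) = P u + y' (b22 (y u))"
    and y': "\<And>v. v \<in> N \<Longrightarrow> y' (b22 v) \<in> R"
  shows "(let M = geo_mean R (\<lambda>u\<in>R. y' (b22 (y u)) + (1/4) *\<^sub>R a u) a;
           G = (\<lambda>u\<in>R. (1/2) *\<^sub>R u + M (inv_op R a u))
       in B = block_op R N a (\<lambda>v\<in>N. inv_op R G (y' (b22 v)))
                (\<lambda>u\<in>R. b22 (y (inv_op R (adj_op R R G) u))) b22) \<longleftrightarrow>
    (\<forall>u\<in>R. \<forall>v\<in>N. B (u + v) = (a u + a (inv_op R P (y' (b22 v)))) + (b22 (y (inv_op R P (a u))) + b22 v))"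
    (is "?L \<longleftrightarrow> _")
proof -
  note R = orth_decompD(1,2)[OF RN]
  have acs: "csymmetric_on R a" using a(1) by (simp add: pos_ops_iff[OF R])
  have bija: "bij_betw a R R" by (rule csymmetric_on_surj_imp_bij[OF R(1) acs a(2)])
  note ai = inv_op_bij[OF bija]
  note aS = csymmetric_onD(2)[OF acs] note PS = csymmetric_onD(2)[OF P(1)]
  define M where "M = (\<lambda>u\<in>R. P u - (1/2) *\<^sub>R a u)"
  have Mcs: "csymmetric_on R (\<lambda>u. P u - (1/2) *\<^sub>R a u)"
    by (auto simp: csymmetric_on_def cinner_simps csymmetric_onD[OF acs] csymmetric_onD[OF P(1)] csubspaceD[OF R(1)])
  have Mpos: "M \<in> pos_ops R"
    unfolding M_def restrict_pos_ops_iff[OF R] using Mcs M by blast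
  have aics: "csymmetric_on R (inv_op R a)" by (rule csymmetric_on_inv_op[OF acs bija])
  have sub: "T (x - (1/2) *\<^sub>R z) = T x - (1/2) *\<^sub>R T z" if "csymmetric_on R T" "x \<in> R" "z \<in> R" for T x z
  proof -
    have "T (x + (-1/2) *\<^sub>R z) = T x + (-1/2) *\<^sub>R T z"
      using symmetric_on_add[OF csubspaceD(1)[OF R(1)] csymmetric_onD(1)[OF that(1)] that(2)]
        symmetric_on_scale[OF csubspaceD(1)[OF R(1)] csymmetric_onD(1)[OF that(1)] that(3)]
        csubspaceD(5)[OF R(1) that(3)] by metis
    then show ?thesis by simp
  qed
  have mean: "geo_mean R (\<lambda>u\<in>R. y' (b22 (y u)) + (1/4) *\<^sub>R a u) a = M"
  proof (rule geo_mean_eqI[OF R a Mpos])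
    fix u assume u: "u \<in> R"
    let ?w = "inv_op R a (P u)"
    have w: "?w \<in> R" "a ?w = P u" using ai PS u by auto
    have Mu: "M u = P u - (1/2) *\<^sub>R a u" using u by (simp add: M_def)
    have iM: "inv_op R a (M u) = ?w - (1/2) *\<^sub>R u"
      unfolding Mu using sub[OF aics PS[OF u] aS[OF u]] ai(3)[OF u] by simp
    then have "M (inv_op R a (M u)) = P (?w - (1/2) *\<^sub>R u) - (1/2) *\<^sub>R a (?w - (1/2) *\<^sub>R u)"
      using w u by (simp add: M_def csubspaceD[OF R(1)])
    also have "\<dots> = P ?w - (1/2) *\<^sub>R P u - (1/2) *\<^sub>R (P u - (1/2) *\<^sub>R a u)"
      using sub[OF P(1) w(1) u] sub[OF acs w(1) u] w(2) by simp
    also have "\<dots> = P ?w - P u + (1/4) *\<^sub>R a u"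
    proof -
      have "P ?w - (1/2) *\<^sub>R P u - (1/2) *\<^sub>R (P u - (1/2) *\<^sub>R a u) =
          P ?w - ((1/2) *\<^sub>R P u + (1/2) *\<^sub>R P u) + (1/4) *\<^sub>R a u"
        by (simp add: scaleR_diff_right)
      then show ?thesis by (simp flip: scaleR_add_left)
    qed
    also have "\<dots> = y' (b22 (y u)) + (1/4) *\<^sub>R a u" using ric[OF u] by simp
    finally show "(\<lambda>u\<in>R. y' (b22 (y u)) + (1/4) *\<^sub>R a u) u = M (inv_op R a (M u))"
      using u by simp
  qed
  define G where "G = (\<lambda>u\<in>R. (1/2) *\<^sub>R u + M (inv_op R a u))"
  have G: "G u = P (inv_op R a u)" if "u \<in> R" for u
    using that ai by (simp add: G_def M_def)
  note inv = inv_op_factor[OF R acs bija P G]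
  have "?L \<longleftrightarrow> B = block_op R N a (\<lambda>v\<in>N. inv_op R G (y' (b22 v)))
                (\<lambda>u\<in>R. b22 (y (inv_op R (adj_op R R G) u))) b22"
    by (simp only: Let_def mean flip: G_def)
  then show ?thesis
    by (simp add: eq_block_op_iff[OF RN] inv y')
qed

section \<open>Passing between the block form and the diamond order\<close>

lemma adj_op_symmetric:
  fixes A :: "'h::complex_hilbert \<Rightarrow> 'h"
  assumes "A \<in> pos_ops UNIV"
  shows "adj_op UNIV UNIV A = A"
proof -
  have "csymmetric_on UNIV A" using assms by (simp add: pos_ops_iff[OF csubspace_UNIV closed_UNIV])
  moreover have "A \<in> bounded_ops UNIV UNIV" using assms by (simp add: pos_ops_def)
  ultimately show ?thesis
    using csubspace_UNIV by (intro adj_op_eqI) (auto simp: csymmetric_on_def)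
qed

lemma diamond_le_pos_iff:
  fixes A B :: "'h::complex_hilbert \<Rightarrow> 'h"
  assumes "A \<in> pos_ops UNIV" "B \<in> pos_ops UNIV"
  shows "diamond_le A B \<longleftrightarrow> range A \<subseteq> range B \<and> (\<forall>x. A (A (A x)) = A (B (A x)))"
  unfolding diamond_le_def adj_op_symmetric[OF assms(1)] adj_op_symmetric[OF assms(2)] fun_eq_iff o_apply
  by blast

lemma block_form_imp_diamond:
  fixes A B a :: "'h::complex_hilbert \<Rightarrow> 'h"
  assumes RN: "orth_decomp R N" and R: "R = range A" and A: "\<And>u v. u \<in> R \<Longrightarrow> v \<in> N \<Longrightarrow> A (u + v) = a u"
    and a: "csymmetric_on R a" "bij_betw a R R" and P: "csymmetric_on R P" "bij_betw P R R"
    and y: "y \<in> bounded_ops R N" and y': "y' \<in> bounded_ops N R" and b22: "csymmetric_on N b22"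
    and ric: "\<And>u. u \<in> R \<Longrightarrow> P (inv_op R a (P u)) = P u + y' (b22 (y u))"
    and B: "\<And>u v. u \<in> R \<Longrightarrow> v \<in> N \<Longrightarrow>
      B (u + v) = (a u + a (inv_op R P (y' (b22 v)))) + (b22 (y (inv_op R P (a u))) + b22 v)"
  shows "range A \<subseteq> range B" "A (A (A x)) = A (B (A x))"
proof -
  note cR = orth_decompD(1)[OF RN] and cN = orth_decompD(3)[OF RN]
  note ai = inv_op_bij[OF a(2)] note Pi = inv_op_bij[OF P(2)]
  note aS = csymmetric_onD(2)[OF a(1)] note PS = csymmetric_onD(2)[OF P(1)]
  note bS = csymmetric_onD(2)[OF b22]
  note yS = bounded_opsD(1)[OF y] and y'S = bounded_opsD(1)[OF y']
  have neg: "T (- x) = - T x" if "csubspace S" "csymmetric_on S T" "x \<in> S" for T x and S :: "'h set"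
    using symmetric_on_scale[OF csubspaceD(1)[OF that(1)] csymmetric_onD(1)[OF that(2)] that(3), of "-1"] by simp
  show "range A \<subseteq> range B"
  proof
    fix r assume "r \<in> range A"
    then have r: "r \<in> R" by (simp add: R)
    \<comment> \<open>The preimage of \<open>r\<close> will be \<open>z - y w\<close>. The equation
      for \<open>P\<close> gives \<open>y' (b22 v) = P (w - z)\<close>, so the \<open>R\<close>-part
      is \<open>a z + a (w - z) = r\<close>; and \<open>a z = P w\<close> makes the
      \<open>N\<close>-part \<open>b22 (y w) - b22 (y w)\<close>.\<close>
    define w where "w = inv_op R a r"
    define z where "z = inv_op R a (P w)"
    have w: "w \<in> R" "a w = r" using ai r by (simp_all add: w_def)
    have z: "z \<in> R" "a z = P w" using ai PS w by (simp_all add: z_def)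
    define v where "v = - y w"
    have v: "v \<in> N" using yS[OF w(1)] csubspaceD(6)[OF cN] by (simp add: v_def)
    have "b22 v = - b22 (y w)" unfolding v_def by (rule neg[OF cN b22 yS[OF w(1)]])
    moreover have "y' (- b22 (y w)) = - y' (b22 (y w))"
      using bounded_opsD(4)[OF y' bS[OF yS[OF w(1)]], of "-1"] by simp
    ultimately have yb: "y' (b22 v) = P w - P z"
      using ric[OF w(1)] by (simp add: z_def)
    have "P (w - z) = P w - P z"
      using symmetric_on_add[OF csubspaceD(1)[OF cR] csymmetric_onD(1)[OF P(1)] w(1) csubspaceD(6)[OF cR z(1)]]
        neg[OF cR P(1) z(1)] by simp
    then have "inv_op R P (y' (b22 v)) = w - z"
      using Pi(3)[OF csubspaceD(4)[OF cR w(1) z(1)]] yb by simp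
    moreover have "a (w - z) = a w - a z"
      using symmetric_on_add[OF csubspaceD(1)[OF cR] csymmetric_onD(1)[OF a(1)] w(1) csubspaceD(6)[OF cR z(1)]]
        neg[OF cR a(1) z(1)] by simp
    ultimately have "B (z + v) = (a z + (a w - a z)) + (b22 (y w) + b22 v)"
      using B[OF z(1) v] Pi(3)[OF w(1)] z(2) by simp
    then have "B (z + v) = r" using \<open>b22 v = - b22 (y w)\<close> w(2) by simp
    then show "r \<in> range B" by blast
  qed
  have xR: "A x \<in> R" by (simp add: R)
  have b0: "b22 0 = 0"
    using symmetric_on_scale[OF csubspaceD(1)[OF cN] csymmetric_onD(1)[OF b22] csubspaceD(7)[OF cN], of 0] by simp
  have y'0: "y' 0 = 0" using bounded_opsD(4)[OF y' csubspaceD(7)[OF cN], of 0] by simp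
  have P0: "inv_op R P 0 = 0" 
    using symmetric_on_scale[OF csubspaceD(1)[OF cR] csymmetric_onD(1)[OF P(1)] csubspaceD(7)[OF cR], of 0] 
      Pi(3)[OF csubspaceD(7)[OF cR]] by simp
  have a0: "a 0 = 0"
    using symmetric_on_scale[OF csubspaceD(1)[OF cR] csymmetric_onD(1)[OF a(1)] csubspaceD(7)[OF cR], of 0] by simp
  have "B (A x) = a (A x) + b22 (y (inv_op R P (a (A x))))"
    using B[OF xR csubspaceD(7)[OF cN]] by (simp add: b0 y'0 P0 a0)
  then have "A (B (A x)) = a (a (A x))"
    using A[OF aS[OF xR] bS[OF yS[OF Pi(1)[OF aS[OF xR]]]]] by simp
  also have "\<dots> = A (A (A x))"
    using A[OF xR csubspaceD(7)[OF cN]] A[OF aS[OF xR] csubspaceD(7)[OF cN]] by simp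
  finally show "A (A (A x)) = A (B (A x))" by simp
qed

text \<open>The compression \<open>L\<close> of the (possibly multivalued) inverse of \<open>B\<close> to \<open>R\<close> is the inverse of the
  Schur complement of \<open>b\<^sub>2\<^sub>2\<close>; one takes \<open>P = a L a\<close>. The vector \<open>y u\<close> solves \<open>B (L (a u) - y u) = a u\<close> and
  is made unique, hence bounded in \<open>u\<close>, by choosing it in the closure of the range of \<open>b\<^sub>2\<^sub>2\<close>.\<close>

lemma diamond_imp_block_form:
  fixes B a :: "'h::complex_hilbert \<Rightarrow> 'h"
  assumes RN: "orth_decomp R N" and B: "csymmetric_on UNIV B" "\<And>x. 0 \<le> inner (B x) x"
    and a: "csymmetric_on R a" "bij_betw a R R" "\<And>u. u \<in> R \<Longrightarrow> 0 \<le> inner (a u) u"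
    and corner: "\<And>u. u \<in> R \<Longrightarrow> B u - a u \<in> N" and ran: "R \<subseteq> range B"
  shows "\<exists>b22\<in>pos_ops N. \<exists>y\<in>bounded_ops R N. \<exists>P. csymmetric_on R P \<and> bij_betw P R R \<and>
    (\<forall>u\<in>R. 0 \<le> inner (P u - (1/2) *\<^sub>R a u) u) \<and>
    (\<forall>u\<in>R. P (inv_op R a (P u)) = P u + adj_op R N y (b22 (y u))) \<and>
    (\<forall>u\<in>R. \<forall>v\<in>N. B (u + v) =
      (a u + a (inv_op R P (adj_op R N y (b22 v)))) + (b22 (y (inv_op R P (a u))) + b22 v))"
proof -
  note R = orth_decompD(1,2)[OF RN] and N = orth_decompD(3,4)[OF RN]
  note orth = orth_decompD(5)[OF RN] and orth' = orth_decompD(6)[OF RN]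
  note Bsym = csymmetric_onD(3)[OF B(1), simplified]
  note Bsy = csymmetric_onD(1)[OF B(1)]
  have Badd: "B (x + z) = B x + B z" for x z using symmetric_on_add[OF subspace_UNIV Bsy] by simp
  have Bscale: "B (r *\<^sub>R x) = r *\<^sub>R B x" for x r using symmetric_on_scale[OF subspace_UNIV Bsy] by simp
  have Bneg: "B (- x) = - B x" for x using Bscale[of "-1" x] by simp
  have Bdiff: "B (x - z) = B x - B z" for x z using Badd[of x "- z"] by (simp add: Bneg)
  obtain k where k: "k > 0" "\<And>x. norm (B x) \<le> k * norm x"
    using symmetric_on_bounded[OF subspace_UNIV closed_UNIV Bsy] by auto
  have Bnorm: "(norm (B x))\<^sup>2 \<le> k * inner (B x) x" for x
    using symmetric_on_norm_le[OF subspace_UNIV Bsy, of k x] B(2) inner_le_of_norm_le[OF k(2)] by simp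
  let ?p = "orth_proj R"
  define b22 where "b22 = (\<lambda>v\<in>N. B v - ?p (B v))"
  note pR = orth_decompD(8)[OF RN] and qN = orth_decompD(7)[OF RN]
  have bN: "b22 v \<in> N" and beq: "b22 v = B v - ?p (B v)" if "v \<in> N" for v
    using that qN by (simp_all add: b22_def)
  have bcin: "cinner (b22 v) w = cinner (B v) w" if "v \<in> N" "w \<in> N" for v w
    using orth[OF pR that(2)] by (simp add: beq[OF that(1)] cinner_diff_left)
  have bcin': "cinner v (b22 w) = cinner v (B w)" if "v \<in> N" "w \<in> N" for v w
    using orth'[OF pR that(1)] by (simp add: beq[OF that(2)] cinner_diff_right)
  have bcs: "csymmetric_on N b22" by (auto simp: csymmetric_on_def bN bcin bcin' Bsym)
  have bpos: "b22 \<in> pos_ops N"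
    using bcs inner_of_cinner[OF bcin] B(2) by (auto simp: pos_ops_iff[OF N] b22_def)
  have badd: "b22 (v + w) = b22 v + b22 w" if "v \<in> N" "w \<in> N" for v w
    by (rule symmetric_on_add[OF csubspaceD(1)[OF N(1)] csymmetric_onD(1)[OF bcs] that])
  have bneg: "b22 (- v) = - b22 v" if "v \<in> N" for v
    using symmetric_on_scale[OF csubspaceD(1)[OF N(1)] csymmetric_onD(1)[OF bcs] that, of "-1"] by simp
  \<comment> \<open>On \<open>N\<close> the forms of \<open>b22\<close> and \<open>B\<close> agree,
    and a zero of the positive form of \<open>B\<close> is a kernel vector.\<close>
  have b_kernel: "B v = 0" if "v \<in> N" "b22 v = 0" for v
    using Bnorm[of v] inner_of_cinner[OF bcin[OF that(1,1)]] that(2) by simp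
  note aS = csymmetric_onD(2)[OF a(1)] and ai = inv_op_bij[OF a(2)]
  define q where "q u = B u - a u" for u
  have qN': "q u \<in> N" if "u \<in> R" for u using corner[OF that] by (simp add: q_def)

  \<comment> \<open>An arbitrary preimage, not linear in \<open>r\<close>. Its \<open>R\<close>-part
    \<open>L r\<close> is nevertheless symmetric in \<open>r\<close>, because
    \<open>cinner (w r) s = cinner (w r) (B (w s))\<close>.\<close>
  define w where "w r = (SOME x. B x = r)" for r
  have w: "B (w r) = r" if "r \<in> R" for r
    using ran that unfolding w_def by (metis (mono_tags) image_iff someI_ex subsetD)
  define L where "L r = ?p (w r)" for r
  have LR: "L r \<in> R" for r by (simp add: L_def pR)
  have Lcin: "cinner (L r) s = cinner (w r) s" if "s \<in> R" for r s
    using orth'[OF that qN, of "w r"] by (simp add: L_def cinner_diff_left)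
  have Lcin': "cinner s (L r) = cinner s (w r)" if "s \<in> R" for r s
    using Lcin[OF that] cinner_commute by metis
  have Lcs: "csymmetric_on R L"
    unfolding csymmetric_on_def
  proof (intro conjI ballI)
    show "cinner (L r) s = cinner r (L s)" if "r \<in> R" "s \<in> R" for r s
      using that Bsym[of "w r" "w s"] by (simp add: Lcin Lcin' w)
  qed (use LR in auto)
  have Linner: "inner (L r) r = inner (B (w r)) (w r)" if "r \<in> R" for r
    using inner_of_cinner[OF Lcin[OF that, of r]] w[OF that] by (simp add: inner_commute)
  \<comment> \<open>This is \<open>Bnorm\<close> at \<open>w r\<close>, whose image under
    \<open>B\<close> is \<open>r\<close>.\<close>
  have Lco: "1 / k * (norm r)\<^sup>2 \<le> inner (L r) r" if "r \<in> R" for r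
    using Bnorm[of "w r"] k(1) w[OF that] by (simp add: Linner[OF that] field_simps)
  have Lbij: "bij_betw L R R"
    using symmetric_on_coercive_surj[OF csubspaceD(1)[OF R(1)] R(2) csymmetric_onD(1)[OF Lcs], of "1/k"] Lco k(1)
    by simp
  note Li = inv_op_bij[OF Lbij]

  define Z where "Z = closure (b22 ` N)"
  have Zcs: "csubspace Z"
  proof -
    have "csubspace (b22 ` N)"
      unfolding csubspace_def subspace_def
    proof (intro conjI ballI allI)
      show "0 \<in> b22 ` N"
        using symmetric_on_scale[OF csubspaceD(1)[OF N(1)] csymmetric_onD(1)[OF bcs] csubspaceD(7)[OF N(1)], of 0]
          csubspaceD(7)[OF N(1)] by (intro image_eqI[of _ _ 0]) auto
      show "x + z \<in> b22 ` N" if "x \<in> b22 ` N" "z \<in> b22 ` N" for x z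
        using that badd csubspaceD(3)[OF N(1)] by (metis (no_types, lifting) image_iff)
      show c: "c *\<^sub>C x \<in> b22 ` N" if "x \<in> b22 ` N" for c x
        using that csymmetric_on_scaleC[OF N(1) bcs] csubspaceD(2)[OF N(1)] by (metis (no_types, lifting) image_iff)
      show "c *\<^sub>R x \<in> b22 ` N" if "x \<in> b22 ` N" for c x
        using c[OF that] by (simp add: scaleR_scaleC)
    qed
    then show ?thesis unfolding Z_def by (rule csubspace_closure)
  qed
  have Zcl: "closed Z" by (simp add: Z_def)
  have ZN: "Z \<subseteq> N" unfolding Z_def using bN N(2) by (intro closure_minimal) auto
  \<comment> \<open>Surjectivity of \<open>L\<close> yields \<open>w r = u + v\<close> with
    prescribed \<open>R\<close>-part \<open>u\<close>. Since \<open>B (u + v)\<close> lies in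
    \<open>R\<close>, its \<open>N\<close>-part \<open>q u + b22 v\<close> vanishes. Projecting
    \<open>- v\<close> onto \<open>Z\<close> discards only a kernel vector of
    \<open>b22\<close>.\<close>
  have "\<exists>z\<in>Z. b22 z = q u" if u: "u \<in> R" for u
  proof -
    define r where "r = inv_op R L u"
    have r: "r \<in> R" "L r = u" using Li u by (simp_all add: r_def)
    define v where "v = w r - u"
    have v: "v \<in> N" using qN[of "w r"] r(2) by (simp add: v_def L_def)
    have "B u + B v = r" using w[OF r(1)] by (simp add: v_def flip: Badd)
    then have eq: "q u + b22 v = r - a u - ?p (B v)" by (simp add: q_def beq[OF v] algebra_simps)
    moreover have "q u + b22 v \<in> N" using qN'[OF u] bN[OF v] csubspaceD(3)[OF N(1)] by blast
    moreover have "r - a u - ?p (B v) \<in> R" using r(1) aS[OF u] pR csubspaceD(4)[OF R(1)] by blast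
    ultimately have "q u + b22 v = 0" using orth_decompD(9)[OF RN] by metis
    then have qv: "b22 (- v) = q u" by (simp add: bneg[OF v] add_eq_0_iff)
    define z where "z = orth_proj Z (- v)"
    have z: "z \<in> Z" by (simp add: z_def orth_proj[OF Zcs Zcl])
    have zN: "z \<in> N" and nv: "- v \<in> N" using z ZN v csubspaceD(6)[OF N(1)] by auto
    have dN: "- v - z \<in> N" using zN nv csubspaceD(4)[OF N(1)] by blast
    have "b22 (- v - z) = 0"
    proof (rule csubspace_cinner_eqI[OF N(1) bN[OF dN] csubspaceD(7)[OF N(1)]])
      fix t assume t: "t \<in> N"
      have "b22 t \<in> Z" unfolding Z_def by (rule subsetD[OF closure_subset imageI[OF t]])
      then have "cinner (- v - z) (b22 t) = 0" unfolding z_def by (rule orth_proj(2)[OF Zcs Zcl])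
      then show "cinner (b22 (- v - z)) t = cinner 0 t"
        using csymmetric_onD(3)[OF bcs dN t] by simp
    qed
    moreover have "b22 (- v) = b22 (- v - z) + b22 z" using badd[OF dN zN] by simp
    ultimately show ?thesis using z qv by (intro bexI[of _ z]) simp_all
  qed
  then obtain W where WZ: "\<And>u. u \<in> R \<Longrightarrow> W u \<in> Z" and Wq: "\<And>u. u \<in> R \<Longrightarrow> b22 (W u) = q u" by metis
  have WN: "W u \<in> N" if "u \<in> R" for u using WZ[OF that] ZN by blast
  have qcin: "cinner (q u) v = cinner (B u) v" if "u \<in> R" "v \<in> N" for u v
    using orth[OF aS[OF that(1)] that(2)] by (simp add: q_def cinner_diff_left)
  \<comment> \<open>For \<open>z = b22 t\<close> one has
    \<open>cinner (W u) z = cinner (q u) t = cinner u (B t)\<close>: an adjoint known on a dense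
    subset of \<open>Z\<close>.\<close>
  have Wb: "restrict W R \<in> bounded_ops R Z"
  proof (rule weak_adjoint_bounded_ops[OF R Zcs _ WZ])
    show "Z \<subseteq> closure (b22 ` N)" by (simp add: Z_def)
    fix u z assume u: "u \<in> R" and z: "z \<in> b22 ` N"
    define t where "t = inv_into N b22 z"
    have t: "t \<in> N" "b22 t = z" using z by (simp_all add: t_def inv_into_into f_inv_into_f)
    have "cinner (W u) z = cinner (b22 (W u)) t" using csymmetric_onD(3)[OF bcs WN[OF u] t(1)] t(2) by simp
    also have "\<dots> = cinner u (B t)" using qcin[OF u t(1)] by (simp add: Wq[OF u] Bsym)
    finally show "cinner (W u) z = cinner u (B (inv_into N b22 z))" by (simp add: t_def)
  qed

  define l where "l u = L (a u)" for u
  have lR: "l u \<in> R" for u by (simp add: l_def LR)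
  define y where "y = (\<lambda>u\<in>R. W (l u))"
  have yb: "y \<in> bounded_ops R N"
  proof -
    have "y (x + z) = y x + y z" if "x \<in> R" "z \<in> R" for x z
    proof -
      have "l (x + z) = l x + l z"
        using that symmetric_on_add[OF csubspaceD(1)[OF R(1)] csymmetric_onD(1)[OF a(1)]]
          symmetric_on_add[OF csubspaceD(1)[OF R(1)] csymmetric_onD(1)[OF Lcs]] aS by (simp add: l_def)
      then show ?thesis
        using that bounded_opsD(2)[OF Wb lR lR, of x z] by (simp add: y_def csubspaceD[OF R(1)] lR)
    qed
    moreover have "y (c *\<^sub>C x) = c *\<^sub>C y x" if "x \<in> R" for c x
    proof -
      have "l (c *\<^sub>C x) = c *\<^sub>C l x"
        using that csymmetric_on_scaleC[OF R(1) a(1)] csymmetric_on_scaleC[OF R(1) Lcs] aS by (simp add: l_def)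
      then show ?thesis
        using that bounded_opsD(3)[OF Wb lR, of c x] by (simp add: y_def csubspaceD[OF R(1)] lR)
    qed
    moreover obtain K where "\<forall>x\<in>R. norm (y x) \<le> K * norm x"
    proof -
      obtain K1 where K1: "\<And>x. x \<in> R \<Longrightarrow> norm (restrict W R x) \<le> K1 * norm x"
        using Wb unfolding bounded_ops_def by blast
      obtain K2 where K2: "K2 > 0" "\<And>x. x \<in> R \<Longrightarrow> norm (L x) \<le> K2 * norm x"
        using symmetric_on_bounded[OF csubspaceD(1)[OF R(1)] R(2) csymmetric_onD(1)[OF Lcs]] by blast
      obtain K3 where K3: "K3 > 0" "\<And>x. x \<in> R \<Longrightarrow> norm (a x) \<le> K3 * norm x"
        using symmetric_on_bounded[OF csubspaceD(1)[OF R(1)] R(2) csymmetric_onD(1)[OF a(1)]] by blast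
      have "norm (y x) \<le> \<bar>K1\<bar> * (K2 * K3) * norm x" if x: "x \<in> R" for x
      proof -
        have "norm (l x) \<le> K2 * norm (a x)" unfolding l_def by (rule K2(2)[OF aS[OF x]])
        also have "\<dots> \<le> K2 * (K3 * norm x)" using K2(1) K3(2)[OF x] by simp
        finally have *: "norm (l x) \<le> K2 * (K3 * norm x)" .
        have "norm (y x) \<le> K1 * norm (l x)" using K1[OF lR, of x] x by (simp add: y_def lR)
        also have "\<dots> \<le> \<bar>K1\<bar> * (K2 * (K3 * norm x))" using * by (intro mult_mono) auto
        finally show ?thesis by (simp add: mult_ac)
      qed
      then show ?thesis using that by blast
    qed
    ultimately show ?thesis
      using WN lR by (auto simp: bounded_ops_def y_def csubspaceD[OF R(1)])
  qed
  note yN = bounded_opsD(1)[OF yb]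
  let ?y' = "adj_op R N y"
  note y'b = adj_op_bounded_ops[OF R N yb]
  have byq: "b22 (y u) = q (l u)" if "u \<in> R" for u using that Wq[OF lR] by (simp add: y_def)
  \<comment> \<open>Both \<open>w (a u)\<close> and \<open>l u - y u\<close> have
    \<open>R\<close>-part \<open>l u\<close>; they differ by a vector of \<open>N\<close> in the
    kernel of \<open>b22\<close>, hence of \<open>B\<close>.\<close>
  have schur: "B (l u - y u) = a u" if u: "u \<in> R" for u
  proof -
    define v where "v = w (a u) - l u"
    have v: "v \<in> N" using qN[of "w (a u)"] by (simp add: v_def l_def L_def)
    have yu: "y u \<in> N" by (rule yN[OF u])
    have vy: "v + y u \<in> N" using v yu csubspaceD(3)[OF N(1)] by blast
    have Bs: "B (l u) + B v = a u" using w[OF aS[OF u]] by (simp add: v_def flip: Badd)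
    have eq: "q (l u) + b22 v = a u - a (l u) - ?p (B v)" using Bs by (simp add: q_def beq[OF v] algebra_simps)
    moreover have "q (l u) + b22 v \<in> N" using qN'[OF lR] bN[OF v] csubspaceD(3)[OF N(1)] by blast
    moreover have "a u - a (l u) - ?p (B v) \<in> R" using aS[OF u] aS[OF lR] pR csubspaceD(4)[OF R(1)] by blast
    ultimately have "q (l u) + b22 v = 0" using orth_decompD(9)[OF RN] by metis
    then have "b22 (v + y u) = 0" using badd[OF v yu] byq[OF u] by (simp add: add.commute)
    then have "B v + B (y u) = 0" using b_kernel[OF vy] by (simp add: Badd)
    then show ?thesis using Bs by (simp add: Bdiff algebra_simps eq_neg_iff_add_eq_0[symmetric])
  qed

  define P where "P u = a (l u)" for u
  have PR: "P u \<in> R" for u by (simp add: P_def aS lR)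
  have Pcs: "csymmetric_on R P"
    unfolding csymmetric_on_def
    by (auto simp: P_def l_def aS LR csymmetric_onD(3)[OF a(1)] csymmetric_onD(3)[OF Lcs])
  have Pbij: "bij_betw P R R"
    unfolding P_def[abs_def] l_def
    using bij_betw_trans[OF bij_betw_trans[OF a(2) Lbij] a(2)] by (simp add: comp_def)
  have Bcorner: "inner (B u) u' = inner (a u) u'" if "u \<in> R" "u' \<in> R" for u u'
    using orth'[OF that(2) corner[OF that(1)]] by (simp add: inner_eq_Re_cinner cinner_diff_left)
  \<comment> \<open>Cauchy-Schwarz for \<open>B\<close> between \<open>w (a u)\<close> and
    \<open>u\<close> gives \<open>a <= P\<close>, the inverted form of
    \<open>s <= a\<close>.\<close>
  have Ppos: "0 \<le> inner (P u - (1/2) *\<^sub>R a u) u" if u: "u \<in> R" for u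
  proof -
    have "(inner (B (w (a u))) u)\<^sup>2 \<le> inner (B (w (a u))) (w (a u)) * inner (B u) u"
      using symmetric_on_Cauchy_Schwarz[OF subspace_UNIV Bsy] B(2) by simp
    also have "inner (B (w (a u))) (w (a u)) = inner (P u) u"
      using Linner[OF aS[OF u]] symmetric_onD(2)[OF csymmetric_onD(1)[OF a(1)] LR u, of "a u"]
      by (simp add: P_def l_def inner_commute)
    finally have cs: "(inner (a u) u)\<^sup>2 \<le> inner (P u) u * inner (a u) u"
      by (simp add: w[OF aS[OF u]] Bcorner[OF u u])
    have "0 \<le> inner (P u) u"
      using Linner[OF aS[OF u]] symmetric_onD(2)[OF csymmetric_onD(1)[OF a(1)] LR u, of "a u"] B(2)[of "w (a u)"]
      by (simp add: P_def l_def inner_commute)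
    then have "inner (a u) u \<le> inner (P u) u"
      using cs a(3)[OF u] by (cases "inner (a u) u = 0") (auto simp: power2_eq_square mult_le_cancel_right)
    then show ?thesis using a(3)[OF u] by (simp add: inner_diff_left)
  qed
  \<comment> \<open>Writing \<open>y s = l s - (l s - y s)\<close> splits
    \<open>cinner (B (l u)) (y s)\<close> into \<open>cinner (P (l u)) s\<close>, from the corner,
    minus \<open>cinner (P u) s\<close>, from \<open>schur\<close>; and
    \<open>l u = a^-1 P u\<close>.\<close>
  have ric: "P (inv_op R a (P u)) = P u + ?y' (b22 (y u))" if u: "u \<in> R" for u
  proof (rule csubspace_cinner_eqI[OF R(1)])
    fix s assume s: "s \<in> R"
    have "cinner (?y' (b22 (y u))) s = cinner (b22 (y u)) (y s)"
      using y'b(2)[OF s bN[OF yN[OF u]]] cinner_commute by metis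
    also have "\<dots> = cinner (B (l u)) (y s)" using qcin[OF lR yN[OF s]] by (simp add: byq[OF u])
    also have "\<dots> = cinner (B (l u)) (l s) - cinner (B (l u)) (l s - y s)" by (simp add: cinner_diff_right)
    also have "cinner (B (l u)) (l s - y s) = cinner (l u) (a s)" by (simp add: Bsym schur[OF s])
    also have "\<dots> = cinner (P u) s" by (simp add: P_def csymmetric_onD(3)[OF a(1) lR s])
    also have "cinner (B (l u)) (l s) = cinner (a (l u)) (l s)"
      using orth'[OF lR corner[OF lR], of u s] by (simp add: cinner_diff_left)
    also have "\<dots> = cinner (P (l u)) s"
      using csymmetric_onD(3)[OF Lcs aS[OF lR] aS[OF s], of u] csymmetric_onD(3)[OF a(1) LR s, of "a (l u)"]
      by (simp add: P_def l_def)
    finally show "cinner (P (inv_op R a (P u))) s = cinner (P u + ?y' (b22 (y u))) s"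
      using ai(3)[OF lR, of u] by (simp add: cinner_add_left P_def)
  qed (use PR bounded_opsD(1)[OF y'b(1) bN[OF yN[OF u]]] csubspaceD(3)[OF R(1)] in auto)
  note Pi = inv_op_bij[OF Pbij]
  have Bu: "B u = a u + b22 (y (inv_op R P (a u)))" if u: "u \<in> R" for u
  proof -
    define z where "z = inv_op R P (a u)"
    have z: "z \<in> R" "P z = a u" using Pi aS[OF u] by (simp_all add: z_def)
    have "l z = inv_op R a (P z)" by (simp add: P_def ai(3)[OF lR])
    also have "\<dots> = u" by (simp only: z(2) ai(3)[OF u])
    finally show ?thesis using byq[OF z(1)] by (simp add: q_def flip: z_def)
  qed
  \<comment> \<open>The \<open>R\<close>-part of \<open>B v\<close> is determined by pairing
    \<open>v\<close> with \<open>B s\<close>, whose blocks are known from \<open>Bu\<close>.\<close>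
  have Bv: "B v = a (inv_op R P (?y' (b22 v))) + b22 v" if v: "v \<in> N" for v
  proof -
    have yv: "?y' (b22 v) \<in> R" by (rule bounded_opsD(1)[OF y'b(1) bN[OF v]])
    have "?p (B v) = a (inv_op R P (?y' (b22 v)))"
    proof (rule csubspace_cinner_eqI[OF R(1) pR aS[OF Pi(1)[OF yv]]])
      fix s assume s: "s \<in> R"
      define z where "z = inv_op R P (a s)"
      have z: "z \<in> R" using Pi aS[OF s] by (simp add: z_def)
      have "cinner (a (inv_op R P (?y' (b22 v)))) s = cinner (?y' (b22 v)) z"
        using csymmetric_onD(3)[OF a(1) Pi(1)[OF yv] s]
          csymmetric_onD(3)[OF csymmetric_on_inv_op[OF Pcs Pbij] yv aS[OF s]] by (simp add: z_def)
      also have "\<dots> = cinner (b22 v) (y z)"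
        using y'b(2)[OF z bN[OF v]] cinner_commute by metis
      also have "\<dots> = cinner v (b22 (y z))" by (rule csymmetric_onD(3)[OF bcs v yN[OF z]])
      also have "\<dots> = cinner v (B s)" using orth'[OF aS[OF s] v] by (simp add: Bu[OF s] z_def cinner_add_right)
      also have "\<dots> = cinner (?p (B v)) s"
        using orth'[OF s qN, of "B v"] by (simp add: cinner_diff_left Bsym)
      finally show "cinner (?p (B v)) s = cinner (a (inv_op R P (?y' (b22 v)))) s" by simp
    qed
    then show ?thesis by (simp add: beq[OF v])
  qed
  have "\<forall>u\<in>R. \<forall>v\<in>N. B (u + v) =
      (a u + a (inv_op R P (?y' (b22 v)))) + (b22 (y (inv_op R P (a u))) + b22 v)"
    by (simp add: Badd Bu Bv)
  then show ?thesis using bpos yb Pcs Pbij Ppos ric by blast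
qed

theorem theorem3p6:
  fixes A B a :: "'h::complex_hilbert \<Rightarrow> 'h"
  assumes "A \<in> pos_ops UNIV" and "B \<in> pos_ops UNIV"
    and "closed (range A)"
    and "a \<in> bounded_ops (range A) (range A)"
    and "A = block_op (range A) (nullspace A) a (\<lambda>_. 0) (\<lambda>_. 0) (\<lambda>_. 0)"
  shows "diamond_le A B \<longleftrightarrow>
    (\<exists>y \<in> bounded_ops (range A) (nullspace A). \<exists>b22 \<in> pos_ops (nullspace A).
       let R = range A; N = nullspace A;
           y' = adj_op R N y;
           M = geo_mean R (\<lambda>u\<in>R. y' (b22 (y u)) + (1/4) *\<^sub>R a u) a;
           G = (\<lambda>u\<in>R. (1/2) *\<^sub>R u + M (inv_op R a u))
       in B = block_op R N
                a                            (\<lambda>v\<in>N. inv_op R G (y' (b22 v)))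
                (\<lambda>u\<in>R. b22 (y (inv_op R (adj_op R R G) u))) b22)"
proof -
  define R where "R = range A"
  define N where "N = nullspace A"
  have Acs: "csymmetric_on UNIV A" "\<And>x. 0 \<le> inner (A x) x"
    and Bcs: "csymmetric_on UNIV B" "\<And>x. 0 \<le> inner (B x) x"
    using assms(1,2) by (simp_all add: pos_ops_iff[OF csubspace_UNIV closed_UNIV])
  have RN: "orth_decomp R N"
    unfolding R_def N_def by (rule nullspace_orth_decomp[OF Acs(1) assms(3)])
  note cR = orth_decompD(1,2)[OF RN] and cN = orth_decompD(3,4)[OF RN]
  have Auv: "A (u + v) = a u" if "u \<in> R" "v \<in> N" for u v
    using block_op_add[OF RN that, of a "\<lambda>_. 0" "\<lambda>_. 0" "\<lambda>_. 0"] assms(5) by (simp add: R_def N_def)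
  have Aa: "A u = a u" if "u \<in> R" for u using Auv[OF that csubspaceD(7)[OF cN(1)]] by simp
  have aR: "a u \<in> R" if "u \<in> R" for u using Aa[OF that] by (metis R_def rangeI)
  have acs: "csymmetric_on R a"
    using csymmetric_onD(3)[OF Acs(1)] aR by (auto simp: csymmetric_on_def simp flip: Aa)
  have apos: "0 \<le> inner (a u) u" if "u \<in> R" for u using Acs(2)[of u] by (simp add: Aa[OF that])
  have asurj: "a ` R = R"
  proof
    show "R \<subseteq> a ` R"
    proof
      fix r assume "r \<in> R"
      then obtain x where x: "r = A x" by (auto simp: R_def)
      have "A x = a (orth_proj R x)"
        using Auv[OF orth_decompD(8)[OF RN] orth_decompD(7)[OF RN], of x x] by simp
      then show "r \<in> a ` R" using x orth_decompD(8)[OF RN] by blast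
    qed
  qed (use aR in blast)
  have abij: "bij_betw a R R" by (rule csymmetric_on_surj_imp_bij[OF cR(1) acs asurj])
  have apos_ops: "a \<in> pos_ops R"
    unfolding pos_ops_iff[OF cR]
    using bounded_opsD(5)[OF assms(4)] acs apos by (simp add: R_def)
  obtain c where c: "c > 0" "\<And>u. u \<in> R \<Longrightarrow> c * (norm u)\<^sup>2 \<le> inner (a u) u"
    using positive_bij_coercive[OF cR acs abij apos] by blast
  let ?cond = "\<lambda>y b22. let y' = adj_op R N y;
           M = geo_mean R (\<lambda>u\<in>R. y' (b22 (y u)) + (1/4) *\<^sub>R a u) a;
           G = (\<lambda>u\<in>R. (1/2) *\<^sub>R u + M (inv_op R a u))
       in B = block_op R N a (\<lambda>v\<in>N. inv_op R G (y' (b22 v)))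
                (\<lambda>u\<in>R. b22 (y (inv_op R (adj_op R R G) u))) b22"
  have "diamond_le A B \<longleftrightarrow> (\<exists>y \<in> bounded_ops R N. \<exists>b22 \<in> pos_ops N. ?cond y b22)"
  proof
    assume "diamond_le A B"
    then have ran: "R \<subseteq> range B" and AAA: "\<And>x. A (A (A x)) = A (B (A x))"
      using diamond_le_pos_iff[OF assms(1,2)] by (auto simp: R_def)
    \<comment> \<open>With \<open>u = A x\<close>, the third diamond condition says that
      \<open>A\<close> does not distinguish \<open>B u\<close> from \<open>a u\<close>.\<close>
    have corner: "B u - a u \<in> N" if u: "u \<in> R" for u
    proof -
      obtain x where x: "u = A x" using u by (auto simp: R_def)
      have "A (B u - a u) = A (B u) + A (- a u)"
        using symmetric_on_add[OF subspace_UNIV csymmetric_onD(1)[OF Acs(1)], of "B u" "- a u"] by simp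
      also have "A (- a u) = - A (a u)"
        using symmetric_on_scale[OF subspace_UNIV csymmetric_onD(1)[OF Acs(1)], of "a u" "-1"] by simp
      also have "A (B u) = A (a u)" using AAA[of x] by (simp add: x Aa[OF u, unfolded x])
      finally show ?thesis by (simp add: N_def nullspace_def)
    qed
    obtain b22 y P where b22: "b22 \<in> pos_ops N" and y: "y \<in> bounded_ops R N"
      and P: "csymmetric_on R P" "bij_betw P R R"
      and ineq: "\<forall>u\<in>R. 0 \<le> inner (P u - (1/2) *\<^sub>R a u) u"
      and ric: "\<forall>u\<in>R. P (inv_op R a (P u)) = P u + adj_op R N y (b22 (y u))"
      and Beq: "\<forall>u\<in>R. \<forall>v\<in>N. B (u + v) =
        (a u + a (inv_op R P (adj_op R N y (b22 v)))) + (b22 (y (inv_op R P (a u))) + b22 v)"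
      using diamond_imp_block_form[OF RN Bcs acs abij apos corner ran] by blast
    have y': "adj_op R N y (b22 v) \<in> R" if "v \<in> N" for v
      using bounded_opsD(1)[OF adj_op_bounded_ops(1)[OF cR cN y]] csymmetric_onD(2)[of N b22] b22 that
      by (simp add: pos_ops_iff[OF cN])
    have "?cond y b22"
      unfolding Let_def[of "adj_op R N y"]
      by (rule block_condition_iff[OF RN apos_ops asurj P, THEN iffD2]) (use ineq ric y' Beq in auto)
    then show "\<exists>y \<in> bounded_ops R N. \<exists>b22 \<in> pos_ops N. ?cond y b22" using y b22 by blast
  next
    assume "\<exists>y \<in> bounded_ops R N. \<exists>b22 \<in> pos_ops N. ?cond y b22"
    then obtain y b22 where y: "y \<in> bounded_ops R N" and b22: "b22 \<in> pos_ops N" and cond: "?cond y b22"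
      by blast
    have bcs: "csymmetric_on N b22" and bpos: "\<And>v. v \<in> N \<Longrightarrow> 0 \<le> inner (b22 v) v"
      using b22 by (simp_all add: pos_ops_iff[OF cN])
    define y' where "y' = adj_op R N y"
    have y'b: "y' \<in> bounded_ops N R"
      and y'c: "\<And>u v. u \<in> R \<Longrightarrow> v \<in> N \<Longrightarrow> cinner (y u) v = cinner u (y' v)"
      unfolding y'_def using adj_op_bounded_ops[OF cR cN y] by blast+
    have y'c': "cinner (y' v) u = cinner v (y u)" if "u \<in> R" "v \<in> N" for u v
      using y'c[OF that] cinner_commute by metis
    note yN = bounded_opsD(1)[OF y] and bN = csymmetric_onD(2)[OF bcs]
    have y'R: "y' (b22 v) \<in> R" if "v \<in> N" for v using bounded_opsD(1)[OF y'b] bN that by blast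
    \<comment> \<open>The summand \<open>a/4\<close> makes \<open>C\<close> coercive even where
      \<open>y' b22 y\<close> degenerates, as the Riccati solution requires.\<close>
    define C where "C u = y' (b22 (y u)) + (1/4) *\<^sub>R a u" for u
    have Ccs: "csymmetric_on R C"
      unfolding csymmetric_on_def
    proof (intro conjI ballI)
      show "cinner (C u) s = cinner u (C s)" if "u \<in> R" "s \<in> R" for u s
        using that y'c[of u "b22 (y s)"] y'c'[of s "b22 (y u)"]
        by (simp add: C_def cinner_simps yN bN csymmetric_onD(3)[OF bcs] csymmetric_onD(3)[OF acs])
    qed (auto simp: C_def y'R yN aR csubspaceD[OF cR(1)])
    have Cco: "c / 4 * (norm u)\<^sup>2 \<le> inner (C u) u" if u: "u \<in> R" for u
    proof -
      have "inner (y' (b22 (y u))) u = inner (b22 (y u)) (y u)"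
        by (rule inner_of_cinner[OF y'c'[OF u bN[OF yN[OF u]]]])
      then show ?thesis using bpos[OF yN[OF u]] c(2)[OF u] by (simp add: C_def inner_add_left)
    qed
    obtain M where M: "M \<in> pos_ops R" "\<And>u. u \<in> R \<Longrightarrow> M (inv_op R a (M u)) = C u"
      using riccati_solution_exists[OF cR acs c Ccs _ Cco] c(1) by (metis divide_pos_pos zero_less_numeral)
    have Mcs: "csymmetric_on R M" and Mpos: "\<And>u. u \<in> R \<Longrightarrow> 0 \<le> inner (M u) u"
      using M(1) by (simp_all add: pos_ops_iff[OF cR])
    note MR = csymmetric_onD(2)[OF Mcs]
    \<comment> \<open>Undoes the completed square; the added \<open>a/2\<close> also makes
      \<open>P\<close> coercive, hence invertible.\<close>
    define P where "P u = M u + (1/2) *\<^sub>R a u" for u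
    have Pcs: "csymmetric_on R P"
      by (auto simp: csymmetric_on_def P_def cinner_simps MR aR csubspaceD[OF cR(1)]
          csymmetric_onD(3)[OF Mcs] csymmetric_onD(3)[OF acs])
    have Pco: "c / 2 * (norm u)\<^sup>2 \<le> inner (P u) u" if "u \<in> R" for u
      using Mpos[OF that] c(2)[OF that] by (simp add: P_def inner_add_left)
    have Pbij: "bij_betw P R R"
      using symmetric_on_coercive_surj[OF csubspaceD(1)[OF cR(1)] cR(2) csymmetric_onD(1)[OF Pcs] _ Pco] c(1)
      by simp
    note ai = inv_op_bij[OF abij]
    have lin: "T (x + (1/2) *\<^sub>R z) = T x + (1/2) *\<^sub>R T z" if "csymmetric_on R T" "x \<in> R" "z \<in> R" for T x z
      using symmetric_on_add[OF csubspaceD(1)[OF cR(1)] csymmetric_onD(1)[OF that(1)] that(2)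
          csubspaceD(5)[OF cR(1) that(3)]]
        symmetric_on_scale[OF csubspaceD(1)[OF cR(1)] csymmetric_onD(1)[OF that(1)] that(3)] by simp
    have ric: "P (inv_op R a (P u)) = P u + y' (b22 (y u))" if u: "u \<in> R" for u
    proof -
      let ?w = "inv_op R a (M u)"
      have w: "?w \<in> R" "a ?w = M u" using ai MR[OF u] by auto
      have "inv_op R a (P u) = ?w + (1/2) *\<^sub>R u"
        using lin[OF csymmetric_on_inv_op[OF acs abij] MR[OF u] aR[OF u]] ai(3)[OF u] by (simp add: P_def)
      then have "P (inv_op R a (P u)) = M (?w + (1/2) *\<^sub>R u) + (1/2) *\<^sub>R a (?w + (1/2) *\<^sub>R u)"
        by (simp add: P_def)
      also have "\<dots> = M ?w + (1/2) *\<^sub>R M u + (1/2) *\<^sub>R (M u + (1/2) *\<^sub>R a u)"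
        using lin[OF Mcs w(1) u] lin[OF acs w(1) u] w(2) by simp
      also have "\<dots> = ((1/2) *\<^sub>R M u + (1/2) *\<^sub>R M u) + (y' (b22 (y u)) + ((1/4) *\<^sub>R a u + (1/4) *\<^sub>R a u))"
        using M(2)[OF u] by (simp add: C_def scaleR_add_right)
      also have "\<dots> = P u + y' (b22 (y u))" by (simp add: P_def flip: scaleR_add_left)
      finally show ?thesis .
    qed
    have Pa: "0 \<le> inner (P u - (1/2) *\<^sub>R a u) u" if "u \<in> R" for u using Mpos[OF that] by (simp add: P_def)
    have "\<forall>u\<in>R. \<forall>v\<in>N. B (u + v) =
        (a u + a (inv_op R P (y' (b22 v)))) + (b22 (y (inv_op R P (a u))) + b22 v)"
      using cond unfolding y'_def[symmetric] Let_def[of y']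
      by (rule block_condition_iff[of R N a P y' b22 y B, OF RN apos_ops asurj Pcs Pbij Pa ric y'R, THEN iffD1, rotated -1])
    then have "range A \<subseteq> range B" "\<And>x. A (A (A x)) = A (B (A x))"
      using block_form_imp_diamond[OF RN R_def Auv acs abij Pcs Pbij y y'b bcs ric] by blast+
    then show "diamond_le A B" using diamond_le_pos_iff[OF assms(1,2)] by blast
  qed
  then show ?thesis by (simp only: R_def N_def Let_def)
qed

end
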